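(* There exist a continuous, even, concave deterministic function $\Lambda:[-1,1]\to[0,\infty)$ and an event $\Omega_0$ with $\mathbb P(\Omega_0)=1$ such that for every realization $(B,F)\in\Omega_0$ and every $\alpha\in[-1,1]$, \[ \lim_{n\to\infty}\frac{\bar A(B,F;n,[\alpha n])}{n}=-\Lambda(\alpha). \]
   Context: Let $c>0$, $q>0$, $\kappa>-1$. On a probability space $(\Omega,\mathcal F,\mathbb P)$ let $F=(F(x))_{x\in\mathbb Z}$ and $B=(B(i))_{i\in\mathbb Z}$ be two mutually independent families of i.i.d. random variables, with $\mathbb P(B(i)=1)=\mathbb P(B(i)=-1)=1/2$, and $F(x)$ having a density $\varrho$ which is even, continuous and strictly positive on $(-c,c)$, vanishes outside $(-c,c)$, and satisfies $\lim_{x\to c}\varrho(x)/|c-x|^{\kappa}=q$. For integers $x_1,x_2$ and $0\le t_1\le t_2$, $\Gamma((t_1,x_1);(t_2,x_2))$ is the set of lazy walks $\gamma:\{t_1,\dots,t_2\}\to\mathbb Z$ with $\gamma(t_1)=x_1$, $\gamma(t_2)=x_2$, $|\gamma(i+1)-\gamma(i)|\le1$. For $b:\mathbb Z\to\{\pm1\}$, $f:\mathbb Z\to[-c,c]$, the action is $A(b,f;\gamma)=\sum_{i=t_1+1}^{t_2}b(i)f(\gamma(i))$, and $\bar A(b,f;(t_1,x_1),(t_2,x_2))=\min_{\gamma\in\Gamma((t_1,x_1);(t_2,x_2))}A(b,f;\gamma)$; $\bar A(b,f;t,x)$ abbreviates $\bar A(b,f;(0,0),(t,x))$. The integer part $[x]$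 rounds towards $0$: $[x]=\lfloor x\rfloor$ for $x\ge0$, $[x]=-\lfloor -x\rfloor$ for $x<0$. *)

theory Defs
  imports "HOL-Probability.Probability"
begin

definition intpart :: "real \<Rightarrow> int" where
  "intpart x = (if x \<ge> 0 then \<lfloor>x\<rfloor> else - \<lfloor>- x\<rfloor>)"

text \<open>Lazy walks from (t1,x1) to (t2,x2); only the values on {t1..t2} matter.\<close>
definition lazy_walks :: "nat \<Rightarrow> int \<Rightarrow> nat \<Rightarrow> int \<Rightarrow> (nat \<Rightarrow> int) set" where
  "lazy_walks t1 x1 t2 x2 =
     {\<gamma>. \<gamma> t1 = x1 \<and> \<gamma> t2 = x2 \<and> (\<forall>i. t1 \<le> i \<and> i < t2 \<longrightarrow> \<bar>\<gamma> (Suc i) - \<gamma> i\<bar> \<le> 1)}"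

definition action :: "(int \<Rightarrow> real) \<Rightarrow> (int \<Rightarrow> real) \<Rightarrow> nat \<Rightarrow> nat \<Rightarrow> (nat \<Rightarrow> int) \<Rightarrow> real" where
  "action b f t1 t2 \<gamma> = (\<Sum>i\<in>{Suc t1..t2}. b (int i) * f (\<gamma> i))"

definition min_action :: "(int \<Rightarrow> real) \<Rightarrow> (int \<Rightarrow> real) \<Rightarrow> nat \<Rightarrow> int \<Rightarrow> nat \<Rightarrow> int \<Rightarrow> real" where
  "min_action b f t1 x1 t2 x2 = Min (action b f t1 t2 ` lazy_walks t1 x1 t2 x2)"

definition min_action0 :: "(int \<Rightarrow> real) \<Rightarrow> (int \<Rightarrow> real) \<Rightarrow> nat \<Rightarrow> int \<Rightarrow> real" where
  "min_action0 b f t x = min_action b f 0 0 t x"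

end

theory Submission
  imports Defs "HOL-Real_Asymp.Real_Asymp"
begin

text \<open>
  The expected minimal action \<open>e n x\<close> is subadditive in \<open>(n, x)\<close>, because the environment is
  stationary under shifts of time and space. Hence \<open>e n x / n\<close> converges when \<open>x / n\<close> tends to
  \<open>\<alpha>\<close> with \<open>\<bar>\<alpha>\<bar> < 1\<close>, and the limit is convex in \<open>\<alpha>\<close>. Near \<open>\<bar>\<alpha>\<bar> = 1\<close> there are only
  \<open>exp (o n)\<close> walks and each has a subgaussian action, so the limit tends to \<open>0\<close> there.

  It remains to see that the minimal action concentrates around its mean. The bounded differences
  inequality does not apply directly, since a walk may stay near one site for a time of order \<open>n\<close>.
  Sites visited more than \<open>n powr (1/4)\<close> times are therefore charged the ideal cost \<open>- c\<close> per
  visit. The resulting capped action has small differences. It is also close to the true action: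
  within distance \<open>n powr (1/8)\<close> of every site there is a pair of neighbours with values almost
  \<open>c\<close> and \<open>- c\<close>, and a walk commuting in this pair according to the signs of \<open>b\<close> pays
  almost \<open>- c\<close> per step.
\<close>

section \<open>The bounded differences inequality\<close>

text \<open>Means replace a subadditive ergodic theorem because the endpoints
  \<open>intpart (\<alpha> * real n)\<close> do not advance by a fixed vector, and because one null
  set has to serve uncountably many speeds. Deviation bounds that are uniform in
  \<open>\<bar>x\<bar> \<le> n\<close> and summable in \<open>n\<close> settle both. The cap
  \<open>L\<close> is squeezed from two sides. With O(n) coordinates of influence O(L), deviations
  of order \<open>n\<close> have an exponent of order \<open>n / L^2\<close>, which must outgrow log
  n. On the other hand up to \<open>n / L\<close> capped sites must each be exchanged for a pair at
  distance up to \<open>r\<close>, at a cost O(r), so \<open>r / L\<close> must vanish. Charging the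
  least conceivable cost makes the capped minimum a lower bound in every environment, so randomness
  enters in one direction of the comparison only. Speeds below 1 leave a walk time to spare for
  correcting its endpoint. This slack disappears at speed 1, where moreover a convex limit could
  jump; exponential moments close the gap.\<close>

lemma nn_integral_PiM_resample:
  fixes M :: "'i \<Rightarrow> 'a measure"
  assumes M: "\<And>i. prob_space (M i)" and g: "g \<in> borel_measurable (PiM UNIV M)"
  shows "(\<integral>\<^sup>+w. g w \<partial>(PiM UNIV M)) = (\<integral>\<^sup>+w. (\<integral>\<^sup>+x. g (w(j := x)) \<partial>(M j)) \<partial>(PiM UNIV M))"
proof -
  interpret P: prob_space "PiM UNIV M" using M by (intro prob_space_PiM) auto
  interpret D: prob_space "M j" by fact
  interpret pair_sigma_finite "M j" "PiM UNIV M" ..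
  have eq: "distr (M j \<Otimes>\<^sub>M PiM UNIV M) (PiM UNIV M) (\<lambda>(x, X). X(j := x)) = PiM UNIV M"
    using distr_pair_PiM_eq_PiM[of UNIV M j] M by simp
  have upd: "(\<lambda>(x, X). X(j := x)) \<in> measurable (M j \<Otimes>\<^sub>M PiM UNIV M) (PiM UNIV M)"
    unfolding case_prod_beta by (intro measurable_fun_upd[where J = UNIV]) auto
  have comp: "(\<lambda>p. g ((snd p)(j := fst p))) \<in> borel_measurable (M j \<Otimes>\<^sub>M PiM UNIV M)"
    using measurable_compose[OF upd g] by (simp add: case_prod_beta)
  have "(\<integral>\<^sup>+w. g w \<partial>(PiM UNIV M))
      = (\<integral>\<^sup>+p. g ((snd p)(j := fst p)) \<partial>(M j \<Otimes>\<^sub>M PiM UNIV M))"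
    by (subst eq[symmetric], subst nn_integral_distr[OF upd]) (auto simp: g case_prod_beta)
  also have "\<dots> = (\<integral>\<^sup>+w. (\<integral>\<^sup>+x. g (w(j := x)) \<partial>(M j)) \<partial>(PiM UNIV M))"
    using nn_integral_snd[OF comp] by simp
  finally show ?thesis .
qed

lemma measurable_PiM_resample:
  fixes M :: "'i \<Rightarrow> 'a measure" and g :: "('i \<Rightarrow> 'a) \<Rightarrow> real"
  assumes M: "\<And>i. prob_space (M i)" and g: "g \<in> borel_measurable (PiM UNIV M)"
  shows "(\<lambda>w. \<integral>x. g (w(j := x)) \<partial>(M j)) \<in> borel_measurable (PiM UNIV M)"
    and "w \<in> space (PiM UNIV M) \<Longrightarrow> (\<lambda>x. g (w(j := x))) \<in> borel_measurable (M j)"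
proof -
  interpret D: prob_space "M j" by fact
  have upd: "(\<lambda>(X, x). X(j := x)) \<in> measurable (PiM UNIV M \<Otimes>\<^sub>M M j) (PiM UNIV M)"
    unfolding case_prod_beta by (intro measurable_fun_upd[where J = UNIV]) auto
  have "(\<lambda>(w, x). g (w(j := x))) \<in> borel_measurable (PiM UNIV M \<Otimes>\<^sub>M M j)"
    using measurable_compose[OF upd g] by (simp add: case_prod_beta)
  then show "(\<lambda>w. \<integral>x. g (w(j := x)) \<partial>(M j)) \<in> borel_measurable (PiM UNIV M)"
    by (rule D.borel_measurable_lebesgue_integral)
  assume "w \<in> space (PiM UNIV M)"
  then show "(\<lambda>x. g (w(j := x))) \<in> borel_measurable (M j)"
    by (intro measurable_compose[OF _ g] measurable_fun_upd[where J = UNIV]) auto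
qed

lemma integral_PiM_resample:
  fixes M :: "'i \<Rightarrow> 'a measure" and g :: "('i \<Rightarrow> 'a) \<Rightarrow> real"
  assumes M: "\<And>i. prob_space (M i)" and g: "g \<in> borel_measurable (PiM UNIV M)"
    and bd: "\<And>w. \<bar>g w\<bar> \<le> K"
  shows "(\<integral>w. g w \<partial>(PiM UNIV M)) = (\<integral>w. (\<integral>x. g (w(j := x)) \<partial>(M j)) \<partial>(PiM UNIV M))"
proof -
  interpret P: prob_space "PiM UNIV M" using M by (intro prob_space_PiM) auto
  interpret D: prob_space "M j" by fact
  interpret Q: pair_prob_space "M j" "PiM UNIV M" ..
  have eq: "distr (M j \<Otimes>\<^sub>M PiM UNIV M) (PiM UNIV M) (\<lambda>(x, X). X(j := x)) = PiM UNIV M"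
    using distr_pair_PiM_eq_PiM[of UNIV M j] M by simp
  have upd: "(\<lambda>(x, X). X(j := x)) \<in> measurable (M j \<Otimes>\<^sub>M PiM UNIV M) (PiM UNIV M)"
    unfolding case_prod_beta by (intro measurable_fun_upd[where J = UNIV]) auto
  have comp: "(\<lambda>p. g ((snd p)(j := fst p))) \<in> borel_measurable (M j \<Otimes>\<^sub>M PiM UNIV M)"
    using measurable_compose[OF upd g] by (simp add: case_prod_beta)
  have "(\<integral>w. g w \<partial>(PiM UNIV M)) = (\<integral>p. g ((snd p)(j := fst p)) \<partial>(M j \<Otimes>\<^sub>M PiM UNIV M))"
    by (subst eq[symmetric], subst integral_distr[OF upd]) (auto simp: g case_prod_beta)
  also have "\<dots> = (\<integral>w. (\<integral>x. g (w(j := x)) \<partial>(M j)) \<partial>(PiM UNIV M))"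
    using Q.integral_snd[of "\<lambda>x w. g (w(j := x))"] comp bd
    by (simp add: case_prod_beta' Q.P.integrable_const_bound[where B = K])
  finally show ?thesis .
qed

text \<open>Averaging out one coordinate \<open>j\<close> at a time takes the place of a martingale.
  The average \<open>h\<close> inherits the differences in the other coordinates. Given those,
  \<open>g - h\<close> is centred in an interval of length \<open>2 * d j\<close>, where Hoeffding's
  lemma gives the factor \<open>exp (l^2 * (d j)^2 / 2)\<close>.\<close>

theorem bounded_differences_mgf:
  fixes M :: "'i \<Rightarrow> 'a measure" and g :: "('i \<Rightarrow> 'a) \<Rightarrow> real"
  assumes M: "\<And>i. prob_space (M i)" and sp: "\<And>i. space (M i) = UNIV" and J: "finite J"
    and g: "g \<in> borel_measurable (PiM UNIV M)" and bd: "\<And>w. \<bar>g w\<bar> \<le> K"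
    and dep: "\<And>w w'. (\<And>j. j \<in> J \<Longrightarrow> w j = w' j) \<Longrightarrow> g w = g w'"
    and diff: "\<And>w j x. j \<in> J \<Longrightarrow> \<bar>g (w(j := x)) - g w\<bar> \<le> d j"
    and l: "l > 0"
  shows "(\<integral>\<^sup>+w. exp (l * (g w - (\<integral>w. g w \<partial>(PiM UNIV M)))) \<partial>(PiM UNIV M))
     \<le> ennreal (exp (l\<^sup>2 * (\<Sum>j\<in>J. (d j)\<^sup>2) / 2))"
  using J g bd dep diff
proof (induction J arbitrary: g rule: finite_induct)
  case empty
  interpret P: prob_space "PiM UNIV M" using M by (intro prob_space_PiM) auto
  have "g w = g w'" for w w' by (rule empty.prems(3)) simp
  then obtain a where "g = (\<lambda>_. a)" by metis
  then show ?case by (simp add: P.prob_space P.emeasure_space_1)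
next
  case (insert j J)
  let ?P = "PiM UNIV M"
  interpret P: prob_space ?P using M by (intro prob_space_PiM) auto
  interpret D: prob_space "M j" by fact
  define h where "h w = (\<integral>x. g (w(j := x)) \<partial>(M j))" for w
  note gm = \<open>g \<in> borel_measurable ?P\<close>
  have [simp]: "space ?P = UNIV" by (simp add: space_PiM sp)
  have hm: "h \<in> borel_measurable ?P"
    unfolding h_def by (rule measurable_PiM_resample(1)[OF M gm])
  have gjm: "(\<lambda>x. g (w(j := x))) \<in> borel_measurable (M j)" for w
    using measurable_PiM_resample(2)[OF M gm] by simp
  have gi: "integrable (M j) (\<lambda>x. g (w(j := x)))" for w
    using gjm insert.prems(2) by (intro D.integrable_const_bound[where B = K]) auto
  have hbd: "\<bar>h w\<bar> \<le> K" for w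
  proof -
    have "\<bar>h w\<bar> \<le> (\<integral>x. \<bar>g (w(j := x))\<bar> \<partial>(M j))"
      unfolding h_def by (rule integral_abs_bound)
    also have "\<dots> \<le> (\<integral>x. K \<partial>(M j))"
      using insert.prems(2) gi by (intro integral_mono) auto
    finally show ?thesis by (simp add: D.prob_space)
  qed
  have hdep: "h w = h w'" if "\<And>i. i \<in> J \<Longrightarrow> w i = w' i" for w w'
    unfolding h_def using that by (intro Bochner_Integration.integral_cong refl insert.prems(3)) auto
  have hdiff: "\<bar>h (w(i := y)) - h w\<bar> \<le> d i" if i: "i \<in> J" for w i y
  proof -
    have "i \<noteq> j" using i insert.hyps by auto
    then have sw: "(w(i := y))(j := x) = (w(j := x))(i := y)" for x by auto
    have dd: "\<bar>g ((w(i := y))(j := x)) - g (w(j := x))\<bar> \<le> d i" for x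
      unfolding sw using i by (intro insert.prems(4)) auto
    have "h (w(i := y)) - h w = (\<integral>x. g ((w(i := y))(j := x)) - g (w(j := x)) \<partial>(M j))"
      unfolding h_def using gi by (subst Bochner_Integration.integral_diff) auto
    also have "\<bar>\<dots>\<bar> \<le> (\<integral>x. \<bar>g ((w(i := y))(j := x)) - g (w(j := x))\<bar> \<partial>(M j))"
      by (rule integral_abs_bound)
    also have "\<dots> \<le> (\<integral>x. d i \<partial>(M j))"
      using dd gi by (intro integral_mono) auto
    finally show ?thesis by (simp add: D.prob_space)
  qed
  have hj: "h (w(j := x)) = h w" for w x by (simp add: h_def)
  have Eh: "(\<integral>w. g w \<partial>?P) = (\<integral>w. h w \<partial>?P)"
    unfolding h_def by (rule integral_PiM_resample[OF M gm insert.prems(2)])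
  have inner: "(\<integral>\<^sup>+x. exp (l * (g (w(j := x)) - h w)) \<partial>(M j)) \<le> ennreal (exp (l\<^sup>2 * (d j)\<^sup>2 / 2))" for w
  proof -
    have dj: "\<bar>g (w(j := x)) - g w\<bar> \<le> d j" for x
      by (rule insert.prems(4)) simp
    have "g (w(j := x)) \<in> {g w - d j..g w + d j}" for x
      using dj[of x] unfolding atLeastAtMost_iff by linarith
    then interpret I: interval_bounded_random_variable "M j" "\<lambda>x. g (w(j := x))" "g w - d j" "g w + d j"
      by unfold_locales (intro gjm AE_I2)+
    have "l\<^sup>2 * (g w + d j - (g w - d j))\<^sup>2 / 8 = l\<^sup>2 * (d j)\<^sup>2 / 2"
      by (simp add: power2_eq_square)
    with I.Hoeffdings_lemma_nn_integral[OF l] show ?thesis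
      by (simp only: h_def)
  qed
  define E where "E = (\<integral>w. h w \<partial>?P)"
  have "(\<integral>\<^sup>+w. exp (l * (g w - E)) \<partial>?P)
      = (\<integral>\<^sup>+w. (\<integral>\<^sup>+x. exp (l * (g (w(j := x)) - E)) \<partial>(M j)) \<partial>?P)"
    using gm by (intro nn_integral_PiM_resample M) simp
  also have "\<dots> = (\<integral>\<^sup>+w. ennreal (exp (l * (h w - E))) * (\<integral>\<^sup>+x. exp (l * (g (w(j := x)) - h w)) \<partial>(M j)) \<partial>?P)"
    using gjm by (intro nn_integral_cong, subst nn_integral_cmult[symmetric])
       (auto simp flip: ennreal_mult exp_add simp: algebra_simps)
  also have "\<dots> \<le> (\<integral>\<^sup>+w. ennreal (exp (l * (h w - E))) * ennreal (exp (l\<^sup>2 * (d j)\<^sup>2 / 2)) \<partial>?P)"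
    by (intro nn_integral_mono mult_left_mono inner) auto
  also have "\<dots> = (\<integral>\<^sup>+w. ennreal (exp (l * (h w - E))) \<partial>?P) * ennreal (exp (l\<^sup>2 * (d j)\<^sup>2 / 2))"
    using hm by (intro nn_integral_multc) simp
  also have "\<dots> \<le> ennreal (exp (l\<^sup>2 * (\<Sum>i\<in>J. (d i)\<^sup>2) / 2)) * ennreal (exp (l\<^sup>2 * (d j)\<^sup>2 / 2))"
    by (intro mult_right_mono insert.IH[of h, folded E_def] hm hbd hdep hdiff) auto
  also have "\<dots> = ennreal (exp (l\<^sup>2 * (\<Sum>i\<in>insert j J. (d i)\<^sup>2) / 2))"
    using insert.hyps by (simp add: algebra_simps add_divide_distrib flip: ennreal_mult exp_add)
  finally show ?case unfolding Eh E_def .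
qed

corollary bounded_differences_tail:
  fixes M :: "'i \<Rightarrow> 'a measure" and g :: "('i \<Rightarrow> 'a) \<Rightarrow> real"
  assumes M: "\<And>i. prob_space (M i)" and sp: "\<And>i. space (M i) = UNIV" and J: "finite J"
    and g: "g \<in> borel_measurable (PiM UNIV M)" and bd: "\<And>w. \<bar>g w\<bar> \<le> K"
    and dep: "\<And>w w'. (\<And>j. j \<in> J \<Longrightarrow> w j = w' j) \<Longrightarrow> g w = g w'"
    and diff: "\<And>w j x. j \<in> J \<Longrightarrow> \<bar>g (w(j := x)) - g w\<bar> \<le> d j"
    and S: "(\<Sum>j\<in>J. (d j)\<^sup>2) \<le> S" "S > 0" and t: "t > 0"
  shows "measure (PiM UNIV M) {w. \<bar>g w - (\<integral>w. g w \<partial>(PiM UNIV M))\<bar> \<ge> t} \<le> 2 * exp (- t\<^sup>2 / (2 * S))"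
proof -
  let ?P = "PiM UNIV M"
  interpret P: prob_space ?P using M by (intro prob_space_PiM) auto
  have [simp]: "space ?P = UNIV" by (simp add: space_PiM sp)
  have upper: "measure ?P {w. f w - (\<integral>w. f w \<partial>?P) \<ge> t} \<le> exp (- t\<^sup>2 / (2 * S))"
    if fm: "f \<in> borel_measurable ?P" and fbd: "\<And>w. \<bar>f w\<bar> \<le> K"
      and fdep: "\<And>w w'. (\<And>j. j \<in> J \<Longrightarrow> w j = w' j) \<Longrightarrow> f w = f w'"
      and fdiff: "\<And>w j x. j \<in> J \<Longrightarrow> \<bar>f (w(j := x)) - f w\<bar> \<le> d j" for f
  proof -
    \<comment> \<open>The minimiser of \<open>- l * t + l^2 * S / 2\<close>, the exponent in the
      Markov bound.\<close>
    define l where "l = t / S"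
    have l: "l > 0" using t S by (simp add: l_def)
    let ?E = "\<integral>w. f w \<partial>?P"
    have "emeasure ?P {w\<in>space ?P. ennreal 1 \<le> ennreal (exp (- l * t)) * ennreal (exp (l * (f w - ?E)))}
       \<le> ennreal (exp (- l * t)) * (\<integral>\<^sup>+w. ennreal (exp (l * (f w - ?E))) \<partial>?P)"
      using nn_integral_Markov_inequality[of "\<lambda>w. ennreal (exp (l * (f w - ?E)))" UNIV ?P "ennreal (exp (- l * t))"] fm
        sets.top[of ?P] by simp
    also have "\<dots> \<le> ennreal (exp (- l * t)) * ennreal (exp (l\<^sup>2 * (\<Sum>j\<in>J. (d j)\<^sup>2) / 2))"
    proof (rule mult_left_mono)
      show "(\<integral>\<^sup>+w. ennreal (exp (l * (f w - ?E))) \<partial>?P) \<le> ennreal (exp (l\<^sup>2 * (\<Sum>j\<in>J. (d j)\<^sup>2) / 2))"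
        by (rule bounded_differences_mgf[where K = K]) (fact M sp J fm fbd fdep fdiff l)+
    qed simp
    also have "\<dots> \<le> ennreal (exp (- l * t)) * ennreal (exp (l\<^sup>2 * S / 2))"
      using S by (intro mult_left_mono ennreal_leI) (auto intro!: mult_left_mono)
    also have "\<dots> = ennreal (exp (- t\<^sup>2 / (2 * S)))"
      using S by (simp add: l_def field_simps power2_eq_square flip: ennreal_mult exp_add)
    also have "{w\<in>space ?P. ennreal 1 \<le> ennreal (exp (- l * t)) * ennreal (exp (l * (f w - ?E)))}
        = {w. f w - ?E \<ge> t}"
    proof -
      have "ennreal 1 \<le> ennreal (exp (- l * t)) * ennreal (exp (l * a)) \<longleftrightarrow> t \<le> a" for a
      proof -
        have "ennreal 1 \<le> ennreal (exp (- l * t)) * ennreal (exp (l * a)) \<longleftrightarrow> 1 \<le> exp (- l * t) * exp (l * a)"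
          by (simp only: ennreal_mult[symmetric] exp_ge_zero ennreal_le_iff mult_nonneg_nonneg)
        also have "\<dots> \<longleftrightarrow> 0 \<le> l * (a - t)"
          by (simp add: right_diff_distrib flip: exp_add)
        finally show ?thesis using l by (simp add: zero_le_mult_iff)
      qed
      then show ?thesis by simp
    qed
    finally show ?thesis by (simp add: P.emeasure_eq_measure)
  qed
  have m: "{w. f w - e \<ge> t} \<in> sets ?P" if "f \<in> borel_measurable ?P" for f e
  proof -
    have "{w \<in> space ?P. t \<le> f w - e} \<in> sets ?P" using that by measurable
    then show ?thesis by simp
  qed
  have "{w. \<bar>g w - (\<integral>w. g w \<partial>?P)\<bar> \<ge> t}
     \<subseteq> {w. g w - (\<integral>w. g w \<partial>?P) \<ge> t} \<union> {w. - g w - (\<integral>w. - g w \<partial>?P) \<ge> t}"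
    by auto
  then have "measure ?P {w. \<bar>g w - (\<integral>w. g w \<partial>?P)\<bar> \<ge> t}
     \<le> measure ?P ({w. g w - (\<integral>w. g w \<partial>?P) \<ge> t} \<union> {w. - g w - (\<integral>w. - g w \<partial>?P) \<ge> t})"
    using g by (intro P.finite_measure_mono sets.Un m borel_measurable_uminus)
  also have "\<dots> \<le> measure ?P {w. g w - (\<integral>w. g w \<partial>?P) \<ge> t} + measure ?P {w. - g w - (\<integral>w. - g w \<partial>?P) \<ge> t}"
    using g by (intro measure_Un_le m borel_measurable_uminus)
  also have "\<dots> \<le> exp (- t\<^sup>2 / (2 * S)) + exp (- t\<^sup>2 / (2 * S))"
  proof (rule add_mono)
    show "measure ?P {w. g w - (\<integral>w. g w \<partial>?P) \<ge> t} \<le> exp (- t\<^sup>2 / (2 * S))"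
      by (rule upper) (fact g bd dep diff)+
    show "measure ?P {w. - g w - (\<integral>w. - g w \<partial>?P) \<ge> t} \<le> exp (- t\<^sup>2 / (2 * S))"
    proof (rule upper)
      show "(\<lambda>w. - g w) \<in> borel_measurable ?P" using g by simp
      show "\<bar>- g w\<bar> \<le> K" for w using bd[of w] by simp
      show "- g w = - g w'" if "\<And>j. j \<in> J \<Longrightarrow> w j = w' j" for w w'
        using dep[OF that] by simp
      show "\<bar>- g (w(j := x)) - - g w\<bar> \<le> d j" if "j \<in> J" for w j x
        using diff[OF that, of w x] by linarith
    qed
  qed
  finally show ?thesis by simp
qed

lemma Min_image_diff_le:
  fixes u v :: "'a \<Rightarrow> real"
  assumes "finite S" and d: "\<And>g. g \<in> S \<Longrightarrow> \<bar>u g - v g\<bar> \<le> d" and "0 \<le> d"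
  shows "\<bar>Min (u ` S) - Min (v ` S)\<bar> \<le> d"
\<comment> \<open>For empty \<open>S\<close> both minima are the same unspecified value
  \<open>Min {}\<close> and the difference is 0. This happens for endpoints outside the cone
  \<open>\<bar>x\<bar> \<le> n\<close>.\<close>
proof (cases "S = {}")
  case False
  have "Min (u ` S) \<le> Min (v ` S) + d" if "\<And>g. g \<in> S \<Longrightarrow> \<bar>u g - v g\<bar> \<le> d" for u v :: "'a \<Rightarrow> real"
  proof -
    have "Min (v ` S) \<in> v ` S" using False \<open>finite S\<close> by (intro Min_in) auto
    then obtain g where g: "g \<in> S" "Min (v ` S) = v g" by auto
    have "Min (u ` S) \<le> u g" using g \<open>finite S\<close> by (intro Min_le) auto
    then show ?thesis using that[OF g(1)] g(2) by linarith
  qed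
  from this[of u v] this[of v u] d show ?thesis by (smt (verit) abs_minus_commute)
qed (use assms in auto)

section \<open>Lazy walks and their action\<close>

text \<open>A walk in \<^const>\<open>lazy_walks\<close> is unconstrained after its final time; fixing these values
  leaves finitely many walks.\<close>
definition walks :: "nat \<Rightarrow> int \<Rightarrow> (nat \<Rightarrow> int) set" where
  "walks n x = {\<gamma> \<in> lazy_walks 0 0 n x. \<forall>i>n. \<gamma> i = 0}"

lemma lazy_walks_bound:
  assumes "\<gamma> \<in> lazy_walks 0 0 n x" "i \<le> n"
  shows "\<bar>\<gamma> i\<bar> \<le> int i"
  using assms(2)
proof (induction i)
  case 0
  then show ?case using assms(1) by (simp add: lazy_walks_def)
next
  case (Suc i)
  then have "\<bar>\<gamma> (Suc i) - \<gamma> i\<bar> \<le> 1" using assms(1) by (simp add: lazy_walks_def)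
  with Suc show ?case by simp
qed

lemma finite_walks: "finite (walks n x)"
proof (rule finite_subset)
  show "walks n x \<subseteq> {\<gamma>. \<forall>i. (i \<in> {..n} \<longrightarrow> \<gamma> i \<in> {-int n..int n}) \<and> (i \<notin> {..n} \<longrightarrow> \<gamma> i = 0)}"
    using lazy_walks_bound by (fastforce simp: walks_def)
qed (intro finite_set_of_finite_funs; simp)

lemma walks_nonempty:
  assumes "\<bar>x\<bar> \<le> int n"
  shows "walks n x \<noteq> {}"
proof -
  \<comment> \<open>Go straight to \<open>x\<close> at unit speed and stay there: \<open>x\<close>
    is clamped to the interval reachable at time \<open>i\<close>.\<close>
  have "(\<lambda>i. if i \<le> n then max (- int i) (min (int i) x) else 0) \<in> walks n x"
    using assms by (auto simp: walks_def lazy_walks_def)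
  then show ?thesis by auto
qed

lemma action_cong: "(\<And>i. 0 < i \<Longrightarrow> i \<le> n \<Longrightarrow> \<gamma> i = \<gamma>' i) \<Longrightarrow> action b f 0 n \<gamma> = action b f 0 n \<gamma>'"
  unfolding action_def by (intro sum.cong) auto

lemma truncate_walk:
  assumes "\<gamma> \<in> lazy_walks 0 0 n x"
  shows "(\<lambda>i. if i \<le> n then \<gamma> i else 0) \<in> walks n x"
  using assms by (auto simp: walks_def lazy_walks_def)

text \<open>\<open>lazy_walks\<close> is infinite, but the action does not read a walk after time
  \<open>n\<close>. The image is therefore finite and \<open>Min\<close> is a genuine
  minimum.\<close>

lemma min_action0_eq: "min_action0 b f n x = Min (action b f 0 n ` walks n x)"
proof -
  have "action b f 0 n ` lazy_walks 0 0 n x = action b f 0 n ` walks n x"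
  proof (intro equalityI subsetI)
    fix a assume "a \<in> action b f 0 n ` lazy_walks 0 0 n x"
    then obtain \<gamma> where \<gamma>: "\<gamma> \<in> lazy_walks 0 0 n x" "a = action b f 0 n \<gamma>" by auto
    have "a = action b f 0 n (\<lambda>i. if i \<le> n then \<gamma> i else 0)"
      unfolding \<gamma>(2) by (rule action_cong) auto
    then show "a \<in> action b f 0 n ` walks n x" using truncate_walk[OF \<gamma>(1)] by blast
  qed (auto simp: walks_def)
  then show ?thesis by (simp add: min_action0_def min_action_def)
qed

lemma min_action0_le:
  assumes "\<gamma> \<in> lazy_walks 0 0 n x"
  shows "min_action0 b f n x \<le> action b f 0 n \<gamma>"
proof -
  have "action b f 0 n \<gamma> = action b f 0 n (\<lambda>i. if i \<le> n then \<gamma> i else 0)"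
    by (rule action_cong) auto
  then show ?thesis
    unfolding min_action0_eq using truncate_walk[OF assms] finite_walks by (intro Min_le) auto
qed

lemma min_action0_attained:
  assumes "\<bar>x\<bar> \<le> int n"
  obtains \<gamma> where "\<gamma> \<in> walks n x" "min_action0 b f n x = action b f 0 n \<gamma>"
proof -
  have "min_action0 b f n x \<in> action b f 0 n ` walks n x"
    unfolding min_action0_eq using finite_walks walks_nonempty[OF assms] by (intro Min_in) auto
  then show ?thesis using that by auto
qed

lemma abs_action_le:
  assumes "\<And>i. \<bar>b i\<bar> \<le> 1" "\<And>x. \<bar>f x\<bar> \<le> c"
  shows "\<bar>action b f 0 n \<gamma>\<bar> \<le> c * real n"
proof -
  have "\<bar>b i * f y\<bar> \<le> 1 * c" for i y unfolding abs_mult using assms(1)[of i] assms(2)[of y]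
    by (intro mult_mono) auto
  then have "(\<Sum>i\<in>{Suc 0..n}. \<bar>b (int i) * f (\<gamma> i)\<bar>) \<le> (\<Sum>i\<in>{Suc 0..n}. c)"
    by (intro sum_mono) simp
  also have "\<dots> = c * real n" by simp
  finally show ?thesis unfolding action_def by (rule order_trans[OF sum_abs])
qed

lemma abs_min_action0_le:
  assumes "\<And>i. \<bar>b i\<bar> \<le> 1" "\<And>x. \<bar>f x\<bar> \<le> c" "\<bar>x\<bar> \<le> int n"
  shows "\<bar>min_action0 b f n x\<bar> \<le> c * real n"
  using min_action0_attained[OF assms(3), of b f] abs_action_le[of b f c n, OF assms(1,2)] by metis

text \<open>Concatenate optimal walks. The second one starts at the space-time point
  \<open>(n, x)\<close> and sees the environment recentred there, which for a stationary environment
  has the same law.\<close>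

lemma min_action0_subadditive:
  assumes x: "\<bar>x\<bar> \<le> int n" and y: "\<bar>y\<bar> \<le> int m"
  shows "min_action0 b f (n + m) (x + y)
    \<le> min_action0 b f n x + min_action0 (\<lambda>i. b (i + int n)) (\<lambda>z. f (z + x)) m y"
proof -
  obtain \<gamma> where \<gamma>: "\<gamma> \<in> walks n x" "min_action0 b f n x = action b f 0 n \<gamma>"
    using min_action0_attained[OF x] by blast
  obtain \<delta> where \<delta>: "\<delta> \<in> walks m y" "min_action0 (\<lambda>i. b (i + int n)) (\<lambda>z. f (z + x)) m y
      = action (\<lambda>i. b (i + int n)) (\<lambda>z. f (z + x)) 0 m \<delta>"
    using min_action0_attained[OF y] by blast
  define \<eta> where "\<eta> i = (if i \<le> n then \<gamma> i else x + \<delta> (i - n))" for i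
  have step: "\<bar>\<eta> (Suc i) - \<eta> i\<bar> \<le> 1" if "i < n + m" for i
  proof -
    consider "i < n" | "i = n" | "i > n" by linarith
    then show ?thesis
    proof cases
      case 1 then show ?thesis using \<gamma>(1) by (auto simp: \<eta>_def walks_def lazy_walks_def)
    next
      case 2
      then have "\<bar>\<delta> (Suc 0) - \<delta> 0\<bar> \<le> 1" "\<delta> 0 = 0" "\<gamma> n = x"
        using \<gamma>(1) \<delta>(1) that by (auto simp: walks_def lazy_walks_def)
      then show ?thesis using 2 by (simp add: \<eta>_def Suc_diff_le)
    next
      case 3
      then have "\<bar>\<delta> (Suc (i - n)) - \<delta> (i - n)\<bar> \<le> 1"
        using \<delta>(1) that by (auto simp: walks_def lazy_walks_def)
      then show ?thesis using 3 by (simp add: \<eta>_def Suc_diff_le)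
    qed
  qed
  have "\<eta> \<in> lazy_walks 0 0 (n + m) (x + y)"
    using \<gamma>(1) \<delta>(1) step by (cases "m = 0") (auto simp: \<eta>_def walks_def lazy_walks_def)
  then have "min_action0 b f (n + m) (x + y) \<le> action b f 0 (n + m) \<eta>" by (rule min_action0_le)
  also have "action b f 0 (n + m) \<eta>
      = (\<Sum>i\<in>{Suc 0..n}. b (int i) * f (\<eta> i)) + (\<Sum>i\<in>{Suc n..n + m}. b (int i) * f (\<eta> i))"
    unfolding action_def by (subst sum.ub_add_nat) auto
  also have "(\<Sum>i\<in>{Suc 0..n}. b (int i) * f (\<eta> i)) = action b f 0 n \<gamma>"
    unfolding action_def by (intro sum.cong) (auto simp: \<eta>_def)
  also have "(\<Sum>i\<in>{Suc n..n + m}. b (int i) * f (\<eta> i))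
      = (\<Sum>i\<in>{Suc 0..m}. b (int (i + n)) * f (\<eta> (i + n)))"
    by (rule sum.reindex_bij_witness[of _ "\<lambda>i. i + n" "\<lambda>i. i - n"]) auto
  also have "\<dots> = action (\<lambda>i. b (i + int n)) (\<lambda>z. f (z + x)) 0 m \<delta>"
    unfolding action_def by (intro sum.cong) (auto simp: \<eta>_def add.commute)
  finally show ?thesis using \<gamma>(2) \<delta>(2) by simp
qed

lemma min_action0_reflect:
  assumes "\<bar>x\<bar> \<le> int n"
  shows "min_action0 b (\<lambda>z. f (- z)) n (- x) = min_action0 b f n x"
proof -
  have le: "min_action0 b (\<lambda>z. f (- z)) n (- x) \<le> min_action0 b f n x"
    if x: "\<bar>x\<bar> \<le> int n" for f and x :: int
  proof -
    obtain \<gamma> where \<gamma>: "\<gamma> \<in> walks n x" "min_action0 b f n x = action b f 0 n \<gamma>"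
      using min_action0_attained[OF x] by blast
    have "(\<lambda>i. - \<gamma> i) \<in> lazy_walks 0 0 n (- x)"
      using \<gamma>(1) by (auto simp: walks_def lazy_walks_def)
    from min_action0_le[OF this, of b "\<lambda>z. f (- z)"] show ?thesis
      using \<gamma>(2) by (simp add: action_def)
  qed
  show ?thesis using le[of x f] le[of "- x" "\<lambda>z. f (- z)"] assms by simp
qed

section \<open>The capped action\<close>

text \<open>Time 0 is left out because the action starts at time 1.\<close>

definition visits :: "nat \<Rightarrow> (nat \<Rightarrow> int) \<Rightarrow> int \<Rightarrow> nat" where
  "visits n \<gamma> y = card {i \<in> {1..n}. \<gamma> i = y}"

text \<open>Sites visited more than \<open>L\<close> times are charged the ideal cost \<open>- c\<close>, so that a single value
  \<open>f y\<close> influences the cost of a walk by at most \<open>2 * c * L\<close>.\<close>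
definition capped_action ::
  "real \<Rightarrow> nat \<Rightarrow> (int \<Rightarrow> real) \<Rightarrow> (int \<Rightarrow> real) \<Rightarrow> nat \<Rightarrow> (nat \<Rightarrow> int) \<Rightarrow> real" where
  "capped_action c L b f n \<gamma> =
     (\<Sum>i\<in>{1..n}. if visits n \<gamma> (\<gamma> i) > L then - c else b (int i) * f (\<gamma> i))"

definition min_capped ::
  "real \<Rightarrow> nat \<Rightarrow> (int \<Rightarrow> real) \<Rightarrow> (int \<Rightarrow> real) \<Rightarrow> nat \<Rightarrow> int \<Rightarrow> real" where
  "min_capped c L b f n x = Min (capped_action c L b f n ` walks n x)"

text \<open>No step costs less than \<open>- c\<close>, so capping lowers the action of every
  walk.\<close>

lemma min_capped_le_min_action0:
  assumes "\<And>i. \<bar>b i\<bar> \<le> 1" "\<And>x. \<bar>f x\<bar> \<le> c" "\<bar>x\<bar> \<le> int n"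
  shows "min_capped c L b f n x \<le> min_action0 b f n x"
proof -
  obtain \<gamma> where \<gamma>: "\<gamma> \<in> walks n x" "min_action0 b f n x = action b f 0 n \<gamma>"
    using min_action0_attained[OF assms(3)] by blast
  have "\<bar>b i * f y\<bar> \<le> 1 * c" for i y unfolding abs_mult using assms(1)[of i] assms(2)[of y]
    by (intro mult_mono) auto
  then have bf: "- c \<le> b i * f y" for i y by (smt (verit))
  have "min_capped c L b f n x \<le> capped_action c L b f n \<gamma>"
    unfolding min_capped_def using \<gamma>(1) finite_walks by (intro Min_le) auto
  also have "\<dots> \<le> action b f 0 n \<gamma>"
    unfolding capped_action_def action_def using bf by (auto intro!: sum_mono)
  finally show ?thesis using \<gamma>(2) by simp
qed

lemma abs_capped_action_le:
  assumes "\<And>i. \<bar>b i\<bar> \<le> 1" "\<And>x. \<bar>f x\<bar> \<le> c"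
  shows "\<bar>capped_action c L b f n \<gamma>\<bar> \<le> c * real n"
proof -
  have "\<bar>b i * f y\<bar> \<le> 1 * c" for i y unfolding abs_mult using assms(1)[of i] assms(2)[of y]
    by (intro mult_mono) auto
  moreover have "0 \<le> c" using assms(2)[of 0] by linarith
  ultimately have "(\<Sum>i\<in>{1..n}. \<bar>if visits n \<gamma> (\<gamma> i) > L then - c else b (int i) * f (\<gamma> i)\<bar>) \<le> (\<Sum>i\<in>{1..n}. c)"
    by (intro sum_mono) auto
  also have "\<dots> = c * real n" by simp
  finally show ?thesis unfolding capped_action_def by (rule order_trans[OF sum_abs])
qed

lemma abs_min_capped_le:
  assumes "\<And>i. \<bar>b i\<bar> \<le> 1" "\<And>x. \<bar>f x\<bar> \<le> c" "\<bar>x\<bar> \<le> int n"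
  shows "\<bar>min_capped c L b f n x\<bar> \<le> c * real n"
proof -
  have "min_capped c L b f n x \<in> capped_action c L b f n ` walks n x"
    unfolding min_capped_def using finite_walks walks_nonempty[OF assms(3)] by (intro Min_in) auto
  then show ?thesis using abs_capped_action_le[of b f c L n, OF assms(1,2)] by auto
qed

lemma min_capped_diff_time:
  assumes b: "\<And>i. \<bar>b i\<bar> \<le> 1" "\<And>i. \<bar>b' i\<bar> \<le> 1" and f: "\<And>x. \<bar>f x\<bar> \<le> c"
    and eq: "\<And>i. i \<noteq> k \<Longrightarrow> b i = b' i"
  shows "\<bar>min_capped c L b f n x - min_capped c L b' f n x\<bar> \<le> 2 * c"
  unfolding min_capped_def
proof (rule Min_image_diff_le[OF finite_walks])
  fix \<gamma>
  have c: "0 \<le> c" using f[of 0] by linarith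
  have "\<bar>b i * f y - b' i * f y\<bar> \<le> 2 * c" for i y
  proof -
    have "\<bar>b i - b' i\<bar> * \<bar>f y\<bar> \<le> 2 * c"
      using b(1)[of i] b(2)[of i] f[of y] by (intro mult_mono) linarith+
    then show ?thesis by (simp add: left_diff_distrib flip: abs_mult)
  qed
  \<comment> \<open>For negative \<open>k\<close> the index \<open>nat k\<close> is 0, outside
    \<open>{1..n}\<close>, and the bounds sum to 0. Otherwise the sign \<open>b k\<close> is read at
    one time only.\<close>
  then have "\<bar>(if visits n \<gamma> (\<gamma> i) > L then - c else b (int i) * f (\<gamma> i))
      - (if visits n \<gamma> (\<gamma> i) > L then - c else b' (int i) * f (\<gamma> i))\<bar> \<le> (if i = nat k then 2 * c else 0)" for i
    using eq[of "int i"] c by (cases "int i = k") auto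
  then have "\<bar>capped_action c L b f n \<gamma> - capped_action c L b' f n \<gamma>\<bar> \<le> (\<Sum>i\<in>{1..n}. if i = nat k then 2 * c else 0)"
    unfolding capped_action_def sum_subtractf[symmetric] by (intro sum_abs[THEN order_trans] sum_mono)
  also have "\<dots> \<le> 2 * c" using c by (simp add: sum.delta)
  finally show "\<bar>capped_action c L b f n \<gamma> - capped_action c L b' f n \<gamma>\<bar> \<le> 2 * c" .
qed (use f[of 0] in linarith)

text \<open>Which sites are capped is decided by the walk alone, hence in the same way for both
  fields. The value at \<open>y\<close> is thus read either never or at most \<open>L\<close>
  times.\<close>

lemma min_capped_diff_space:
  assumes b: "\<And>i. \<bar>b i\<bar> \<le> 1" and f: "\<And>x. \<bar>f x\<bar> \<le> c" "\<And>x. \<bar>f' x\<bar> \<le> c"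
    and eq: "\<And>x. x \<noteq> y \<Longrightarrow> f x = f' x"
  shows "\<bar>min_capped c L b f n x - min_capped c L b f' n x\<bar> \<le> 2 * c * real L"
  unfolding min_capped_def
proof (rule Min_image_diff_le[OF finite_walks])
  fix \<gamma>
  have c: "0 \<le> c" using f(1)[of 0] by linarith
  have bd: "\<bar>b i * f z - b i * f' z\<bar> \<le> 2 * c" for i z
  proof -
    have "\<bar>b i\<bar> * \<bar>f z - f' z\<bar> \<le> 1 * (2 * c)"
      using b[of i] f(1)[of z] f(2)[of z] by (intro mult_mono) linarith+
    then show ?thesis by (simp add: right_diff_distrib flip: abs_mult)
  qed
  have "\<bar>(if visits n \<gamma> (\<gamma> i) > L then - c else b (int i) * f (\<gamma> i))
      - (if visits n \<gamma> (\<gamma> i) > L then - c else b (int i) * f' (\<gamma> i))\<bar>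
      \<le> (if \<gamma> i = y \<and> visits n \<gamma> y \<le> L then 2 * c else 0)" for i
    using eq[of "\<gamma> i"] c bd[of "int i" "\<gamma> i"] by (cases "\<gamma> i = y") auto
  then have "\<bar>capped_action c L b f n \<gamma> - capped_action c L b f' n \<gamma>\<bar>
      \<le> (\<Sum>i\<in>{1..n}. if \<gamma> i = y \<and> visits n \<gamma> y \<le> L then 2 * c else 0)"
    unfolding capped_action_def sum_subtractf[symmetric] by (intro sum_abs[THEN order_trans] sum_mono)
  also have "\<dots> = (if visits n \<gamma> y \<le> L then 2 * c * real (visits n \<gamma> y) else 0)"
    by (simp add: visits_def sum.If_cases Int_def)
  also have "\<dots> \<le> 2 * c * real L" using c by (auto intro: mult_left_mono)
  finally show "\<bar>capped_action c L b f n \<gamma> - capped_action c L b f' n \<gamma>\<bar> \<le> 2 * c * real L" .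
qed (use f(1)[of 0] in simp)

text \<open>Minimum and maximum preserve sequences with steps of size at most 1. A unit-speed walk,
  confined to a window whose ends move at unit speed, therefore stays a lazy walk.\<close>

lemma clip_step:
  fixes y m m' g g' :: int
  assumes "\<bar>m' - m\<bar> \<le> 1" "\<bar>g' - g\<bar> \<le> 1"
  shows "\<bar>max (y - m') (min (y + m') g') - max (y - m) (min (y + m) g)\<bar> \<le> 1"
proof -
  have "\<bar>min (y + m') g' - min (y + m) g\<bar> \<le> 1"
    using assms unfolding min_def by (simp split: if_split; linarith)
  moreover have "\<bar>(y - m') - (y - m)\<bar> \<le> 1" using assms by linarith
  moreover have "\<bar>max p' q' - max p q\<bar> \<le> 1" if "\<bar>p' - p\<bar> \<le> 1" "\<bar>q' - q\<bar> \<le> 1" for p p' q q' :: int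
    using that unfolding max_def by (simp split: if_split; linarith)
  ultimately show ?thesis by blast
qed

text \<open>Between its first and its last visit to \<open>y\<close> the walk may instead
  commute inside a nearby pair of sites whose values are almost \<open>c\<close> and \<open>- c\<close>. Clipping the
  commuting walk \<open>g\<close> to a window around \<open>y\<close> that opens and closes at unit speed joins it to the
  rest. The cost of a step is cut off at \<open>- (c - e)\<close>, which the pair attains, so that the loss does
  not accumulate when several sites are treated in turn.\<close>
lemma replace_visits:
  fixes b f :: "int \<Rightarrow> real" and c e :: real and r n :: nat
  assumes b: "\<And>i. i \<in> {1..n} \<Longrightarrow> b (int i) = 1 \<or> b (int i) = -1"
    and f: "\<And>x. \<bar>f x\<bar> \<le> c" and e: "0 \<le> e" "e \<le> c" and r: "1 \<le> r"
    and pair: "\<And>y. \<bar>y\<bar> \<le> int n \<Longrightarrow>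
      \<exists>z. \<bar>z - y\<bar> \<le> int r \<and> \<bar>z + 1 - y\<bar> \<le> int r \<and> c - e \<le> f z \<and> f (z + 1) \<le> - (c - e)"
    and H: "finite H" and \<gamma>: "\<gamma> \<in> lazy_walks 0 0 n x"
  defines "u \<equiv> \<lambda>i y. max (b (int i) * f y) (- (c - e))"
  shows "\<exists>\<gamma>'\<in>lazy_walks 0 0 n x. (\<Sum>i\<in>{1..n}. u i (\<gamma>' i))
    \<le> (\<Sum>i\<in>{1..n}. if \<gamma> i \<in> H then - (c - e) else u i (\<gamma> i)) + 4 * c * real r * real (card H)"
  using H \<gamma>
proof (induction H arbitrary: \<gamma> rule: finite_induct)
  case empty
  then show ?case by (intro bexI[of _ \<gamma>]) auto
next
  case (insert y H)
  have c: "0 \<le> c" using e by linarith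
  have u_le: "u i z \<le> c" if "i \<in> {1..n}" for i z
    using b[OF that] f[of z] e c by (auto simp: u_def)
  have u_ge: "- (c - e) \<le> u i z" for i z by (simp add: u_def)
  let ?V = "{i \<in> {1..n}. \<gamma> i = y}"
  show ?case
  \<comment> \<open>Replacements made for other sites may have erased all visits to
    \<open>y\<close>; then nothing is owed for it.\<close>
  proof (cases "?V = {}")
    case True
    have "(\<Sum>i\<in>{1..n}. if \<gamma> i \<in> insert y H then - (c - e) else u i (\<gamma> i))
      = (\<Sum>i\<in>{1..n}. if \<gamma> i \<in> H then - (c - e) else u i (\<gamma> i))"
      using True by (intro sum.cong) auto
    moreover have "4 * c * real r * real (card H) \<le> 4 * c * real r * real (card (insert y H))"
      using insert.hyps c by (intro mult_left_mono) auto
    moreover obtain \<gamma>' where "\<gamma>' \<in> lazy_walks 0 0 n x" "(\<Sum>i\<in>{1..n}. u i (\<gamma>' i))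
      \<le> (\<Sum>i\<in>{1..n}. if \<gamma> i \<in> H then - (c - e) else u i (\<gamma> i)) + 4 * c * real r * real (card H)"
      using insert.IH[OF insert.prems] by blast
    ultimately show ?thesis by (intro bexI[of _ \<gamma>']) linarith+
  next
    case False
    define s where "s = Min ?V"
    define t where "t = Max ?V"
    have V: "s \<in> ?V" "t \<in> ?V" unfolding s_def t_def using False by (intro Min_in Max_in; simp)+
    have st: "s \<le> i \<and> i \<le> t" if "i \<in> ?V" for i
      using that unfolding s_def t_def by simp
    have "\<bar>y\<bar> \<le> int n" using lazy_walks_bound[OF insert.prems, of s] V by auto
    then obtain z where z: "\<bar>z - y\<bar> \<le> int r" "\<bar>z + 1 - y\<bar> \<le> int r" "c - e \<le> f z" "f (z + 1) \<le> - (c - e)"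
      using pair by blast
    \<comment> \<open>Sign 1 calls for the low site \<open>z + 1\<close>, sign -1 for the high site
      \<open>z\<close>, so every step costs at most \<open>- (c - e)\<close>.\<close>
    define g where "g i = (if b (int i) = 1 then z + 1 else z)" for i
    have ug: "u i (g i) = - (c - e)" if "i \<in> {1..n}" for i
      using b[OF that] z by (auto simp: u_def g_def)
    \<comment> \<open>Half-width of the window: 0 at the first and the last visit, and at least
      \<open>r\<close> once both are \<open>r\<close> steps away, where clipping has no
      effect.\<close>
    define m where "m i = min (int i - int s) (int t - int i)" for i
    define \<delta> where "\<delta> i = (if s \<le> i \<and> i \<le> t then max (y - m i) (min (y + m i) (g i)) else \<gamma> i)" for i
    have \<delta>s: "\<delta> s = y" "\<delta> t = y" using V st by (auto simp: \<delta>_def m_def)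
    have \<gamma>s: "\<gamma> s = y" "\<gamma> t = y" using V by auto
    have out: "\<delta> i = \<gamma> i" if "i \<le> s \<or> t \<le> i" for i
      using that \<delta>s \<gamma>s by (cases "i = s"; cases "i = t") (auto simp: \<delta>_def)
    have "\<bar>\<delta> (Suc i) - \<delta> i\<bar> \<le> 1" if i: "i < n" for i
    proof (cases "s \<le> i \<and> Suc i \<le> t")
      case True
      have "\<bar>m (Suc i) - m i\<bar> \<le> 1" unfolding m_def min_def by (simp split: if_split)
      moreover have "\<bar>g (Suc i) - g i\<bar> \<le> 1" by (auto simp: g_def)
      ultimately have "\<bar>max (y - m (Suc i)) (min (y + m (Suc i)) (g (Suc i)))
          - max (y - m i) (min (y + m i) (g i))\<bar> \<le> 1" by (rule clip_step)
      then show ?thesis using True unfolding \<delta>_def by simp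
    next
      case False
      then have "\<delta> (Suc i) = \<gamma> (Suc i)" "\<delta> i = \<gamma> i" by (intro out; linarith)+
      then show ?thesis using insert.prems i by (auto simp: lazy_walks_def)
    qed
    moreover have "\<delta> 0 = \<gamma> 0" "\<delta> n = \<gamma> n" using V by (auto intro!: out)
    ultimately have \<delta>: "\<delta> \<in> lazy_walks 0 0 n x"
      using insert.prems by (auto simp: lazy_walks_def)
    \<comment> \<open>The transition times, at most \<open>2 * r\<close> of them. As
      \<open>u\<close> lies between \<open>- (c - e)\<close> and \<open>c\<close>, each loses at
      most \<open>2 * c\<close>, in total \<open>4 * c * r\<close>.\<close>
    let ?E = "{i\<in>{1..n}. i \<in> {s..<s+r} \<union> {t+1-r..t}}"
    \<comment> \<open>Between \<open>s\<close> and \<open>t\<close>, off the transitions, the new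
      walk attains the floor \<open>- (c - e)\<close>. It cannot lose there against anything the old
      walk did, at \<open>y\<close> or elsewhere.\<close>
    have le: "(if \<delta> i \<in> H then - (c - e) else u i (\<delta> i))
      \<le> (if \<gamma> i \<in> insert y H then - (c - e) else u i (\<gamma> i)) + (if i \<in> ?E then 2 * c else 0)"
      if i: "i \<in> {1..n}" for i
    proof -
      consider "i < s \<or> t < i" | "i \<in> ?E" | "s \<le> i" "i \<le> t" "i \<notin> ?E" using not_less by blast
      then show ?thesis
      proof cases
        case 1
        then have "\<gamma> i \<noteq> y" using st[of i] i by auto
        moreover have "\<delta> i = \<gamma> i" using 1 by (intro out) auto
        ultimately show ?thesis using c by simp
      next
        case 2
        then show ?thesis using u_le[OF i, of "\<delta> i"] u_ge[of i "\<gamma> i"] c e by auto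
      next
        case 3
        then have "s + r \<le> i" "i + r \<le> t" using i by auto
        then have "int r \<le> m i" by (auto simp: m_def)
        then have "\<delta> i = g i" using 3 z by (auto simp: \<delta>_def g_def)
        then show ?thesis using 3 ug[OF i] u_ge[of i "\<gamma> i"] by auto
      qed
    qed
    have "card ?E \<le> card ({s..<s+r} \<union> {t+1-r..t})" by (intro card_mono) auto
    also have "\<dots> \<le> card {s..<s+r} + card {t+1-r..t}" by (rule card_Un_le)
    also have "\<dots> \<le> 2 * r" by simp
    finally have E: "real (card ?E) \<le> 2 * real r" by linarith
    have "(\<Sum>i\<in>{1..n}. if \<delta> i \<in> H then - (c - e) else u i (\<delta> i))
      \<le> (\<Sum>i\<in>{1..n}. (if \<gamma> i \<in> insert y H then - (c - e) else u i (\<gamma> i)) + (if i \<in> ?E then 2 * c else 0))"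
      by (intro sum_mono le)
    also have "\<dots> = (\<Sum>i\<in>{1..n}. if \<gamma> i \<in> insert y H then - (c - e) else u i (\<gamma> i)) + real (card ?E) * (2 * c)"
    proof -
      have "{1..n} \<inter> ?E = ?E" by blast
      then show ?thesis by (simp only: sum.distrib sum.If_cases[OF finite_atLeastAtMost]) (simp add: Int_def)
    qed
    also have "\<dots> \<le> (\<Sum>i\<in>{1..n}. if \<gamma> i \<in> insert y H then - (c - e) else u i (\<gamma> i)) + 2 * real r * (2 * c)"
      using E c by (intro add_left_mono mult_right_mono) auto
    finally have 1: "(\<Sum>i\<in>{1..n}. if \<delta> i \<in> H then - (c - e) else u i (\<delta> i))
      \<le> (\<Sum>i\<in>{1..n}. if \<gamma> i \<in> insert y H then - (c - e) else u i (\<gamma> i)) + 4 * c * real r" by (simp add: mult_ac)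
    obtain \<gamma>' where "\<gamma>' \<in> lazy_walks 0 0 n x" "(\<Sum>i\<in>{1..n}. u i (\<gamma>' i))
      \<le> (\<Sum>i\<in>{1..n}. if \<delta> i \<in> H then - (c - e) else u i (\<delta> i)) + 4 * c * real r * real (card H)"
      using insert.IH[OF \<delta>] by blast
    moreover have "4 * c * real r * real (card (insert y H)) = 4 * c * real r * real (card H) + 4 * c * real r"
      using insert.hyps by (simp add: algebra_simps)
    ultimately show ?thesis using 1 by (intro bexI[of _ \<gamma>']) linarith+
  qed
qed

text \<open>Each capped site occupies more than \<open>L\<close> of the \<open>n\<close> times, so
  there are at most \<open>n / L\<close> of them, and \<open>replace_visits\<close> charges
  \<open>4 * c * r\<close> for each. The term \<open>e * n\<close> pays for the floor
  \<open>- (c - e)\<close> in place of \<open>- c\<close>.\<close>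

lemma min_action0_le_min_capped:
  fixes b f :: "int \<Rightarrow> real" and c e :: real and r n :: nat
  assumes b: "\<And>i. i \<in> {1..n} \<Longrightarrow> b (int i) = 1 \<or> b (int i) = -1"
    and f: "\<And>x. \<bar>f x\<bar> \<le> c" and e: "0 \<le> e" "e \<le> c" and r: "1 \<le> r" and L: "1 \<le> L"
    and pair: "\<And>y. \<bar>y\<bar> \<le> int n \<Longrightarrow>
      \<exists>z. \<bar>z - y\<bar> \<le> int r \<and> \<bar>z + 1 - y\<bar> \<le> int r \<and> c - e \<le> f z \<and> f (z + 1) \<le> - (c - e)"
    and x: "\<bar>x\<bar> \<le> int n"
  shows "min_action0 b f n x \<le> min_capped c L b f n x + (e + 4 * c * real r / real L) * real n"
proof -
  have c: "0 \<le> c" using e by linarith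
  have "min_capped c L b f n x \<in> capped_action c L b f n ` walks n x"
    unfolding min_capped_def using finite_walks walks_nonempty[OF x] by (intro Min_in) auto
  then obtain \<gamma> where \<gamma>: "\<gamma> \<in> walks n x" "min_capped c L b f n x = capped_action c L b f n \<gamma>" by auto
  define H where "H = {y \<in> \<gamma> ` {1..n}. visits n \<gamma> y > L}"
  have H: "finite H" by (simp add: H_def)
  have "L * card H = (\<Sum>y\<in>H. L)" by simp
  also have "\<dots> \<le> (\<Sum>y\<in>H. visits n \<gamma> y)" by (intro sum_mono) (auto simp: H_def)
  also have "\<dots> = card (\<Union>y\<in>H. {i \<in> {1..n}. \<gamma> i = y})"
    unfolding visits_def using H by (intro card_UN_disjoint[symmetric]) auto
  also have "\<dots> \<le> card {1..n}" by (intro card_mono) auto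
  finally have "real L * real (card H) \<le> real n" by (simp flip: of_nat_mult)
  then have cardH: "real (card H) \<le> real n / real L" using L by (simp add: field_simps)
  let ?u = "\<lambda>i y. max (b (int i) * f y) (- (c - e))"
  have "\<gamma> \<in> lazy_walks 0 0 n x" using \<gamma>(1) by (simp add: walks_def)
  from replace_visits[where b = b and f = f and c = c and e = e and r = r, OF b f e r pair H this]
  obtain \<gamma>' where \<gamma>': "\<gamma>' \<in> lazy_walks 0 0 n x" and le: "(\<Sum>i\<in>{1..n}. ?u i (\<gamma>' i))
    \<le> (\<Sum>i\<in>{1..n}. if \<gamma> i \<in> H then - (c - e) else ?u i (\<gamma> i)) + 4 * c * real r * real (card H)"
    by blast
  have "min_action0 b f n x \<le> action b f 0 n \<gamma>'" by (rule min_action0_le[OF \<gamma>'])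
  also have "\<dots> \<le> (\<Sum>i\<in>{1..n}. ?u i (\<gamma>' i))" unfolding action_def by (auto intro!: sum_mono)
  also note le
  also have "(\<Sum>i\<in>{1..n}. if \<gamma> i \<in> H then - (c - e) else ?u i (\<gamma> i))
    \<le> (\<Sum>i\<in>{1..n}. (if visits n \<gamma> (\<gamma> i) > L then - c else b (int i) * f (\<gamma> i)) + e)"
  proof (intro sum_mono)
    fix i assume i: "i \<in> {1..n}"
    have "- c \<le> b (int i) * f (\<gamma> i)" using b[OF i] f[of "\<gamma> i"] by auto
    then show "(if \<gamma> i \<in> H then - (c - e) else ?u i (\<gamma> i))
      \<le> (if visits n \<gamma> (\<gamma> i) > L then - c else b (int i) * f (\<gamma> i)) + e"
      using i e by (auto simp: H_def)
  qed
  also have "\<dots> = capped_action c L b f n \<gamma> + e * real n"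
    by (simp add: capped_action_def sum.distrib)
  also have "4 * c * real r * real (card H) \<le> 4 * c * real r * (real n / real L)"
    using cardH c by (intro mult_left_mono) auto
  finally show ?thesis using \<gamma>(2) by (simp add: algebra_simps)
qed

section \<open>Subadditive arrays\<close>

lemma abs_intpart_le: "\<bar>real_of_int (intpart x)\<bar> \<le> \<bar>x\<bar>"
  unfolding intpart_def by (auto; linarith)

lemma abs_intpart_diff: "\<bar>real_of_int (intpart x) - x\<bar> \<le> 1"
  unfolding intpart_def by (auto; linarith)

text \<open>Oddness, which rounding down would not have, turns the reflection of the environment
  into evenness of the limit.\<close>

lemma intpart_minus: "intpart (- x) = - intpart x"
  unfolding intpart_def by (cases "x = 0") auto

lemma abs_intpart_le_nat:
  assumes "\<alpha> \<in> {-1..1}"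
  shows "\<bar>intpart (\<alpha> * real n)\<bar> \<le> int n"
proof -
  have "\<bar>real_of_int (intpart (\<alpha> * real n))\<bar> \<le> \<bar>\<alpha> * real n\<bar>" by (rule abs_intpart_le)
  also have "\<dots> \<le> 1 * real n" unfolding abs_mult using assms by (intro mult_mono) auto
  finally show ?thesis by linarith
qed

lemma intpart_ratio_tendsto: "(\<lambda>n. real_of_int (intpart (\<alpha> * real n)) / real n) \<longlonglongrightarrow> \<alpha>"
proof (rule LIM_zero_cancel, rule Lim_null_comparison)
  have "\<bar>real_of_int (intpart (\<alpha> * real n)) / real n - \<alpha>\<bar> \<le> 1 / real n" if "n > 0" for n :: nat
  proof -
    have "real_of_int (intpart (\<alpha> * real n)) / real n - \<alpha>
        = (real_of_int (intpart (\<alpha> * real n)) - \<alpha> * real n) / real n"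
      using that by (simp add: field_simps)
    then show ?thesis using abs_intpart_diff[of "\<alpha> * real n"] that by (simp add: divide_right_mono)
  qed
  then show "\<forall>\<^sub>F n in sequentially. norm (real_of_int (intpart (\<alpha> * real n)) / real n - \<alpha>) \<le> 1 / real n"
    by (auto intro: eventually_sequentiallyI[of 1])
  show "(\<lambda>n. 1 / real n) \<longlonglongrightarrow> 0" by (rule lim_1_over_n)
qed

text \<open>A Fekete argument with errors. Let \<open>l\<close> be a subsequential limit: a late
  term near \<open>l\<close> bounds all sufficiently late terms from above, and every late term is
  bounded from below by a still later term near \<open>l\<close>.\<close>

lemma convergent_if_almost_decreasing:
  fixes u :: "nat \<Rightarrow> real"
  assumes bd: "\<And>n. \<bar>u n\<bar> \<le> C"
    and dec: "\<And>e. e > 0 \<Longrightarrow> \<exists>M. \<forall>m\<ge>M. \<exists>N. \<forall>n\<ge>N. u n \<le> u m + e"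
  shows "convergent u"
proof -
  have "bounded (range u)" using bd by (auto simp: bounded_iff)
  then obtain l r where r: "strict_mono r" "(u \<circ> r) \<longlonglongrightarrow> l"
    using bounded_imp_convergent_subsequence by blast
  have "u \<longlonglongrightarrow> l"
  proof (rule LIMSEQ_I)
    fix e :: real assume e: "e > 0"
    obtain M where M: "\<And>m. m \<ge> M \<Longrightarrow> \<exists>N. \<forall>n\<ge>N. u n \<le> u m + e / 3"
      using dec[of "e / 3"] e by auto
    obtain K where K: "\<And>k. k \<ge> K \<Longrightarrow> \<bar>u (r k) - l\<bar> < e / 3"
      using LIMSEQ_D[OF r(2), of "e / 3"] e by auto
    have "r (max K M) \<ge> M" using seq_suble[OF r(1), of "max K M"] by linarith
    then obtain N where N: "\<And>n. n \<ge> N \<Longrightarrow> u n \<le> u (r (max K M)) + e / 3" using M by blast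
    have "norm (u n - l) < e" if n: "n \<ge> max N M" for n
    proof -
      obtain N' where N': "\<And>k. k \<ge> N' \<Longrightarrow> u k \<le> u n + e / 3" using M[of n] n by auto
      have "r (max K N') \<ge> N'" using seq_suble[OF r(1), of "max K N'"] by linarith
      then have "u (r (max K N')) \<le> u n + e / 3" by (rule N')
      moreover have "\<bar>u (r (max K N')) - l\<bar> < e / 3" "\<bar>u (r (max K M)) - l\<bar> < e / 3" by (rule K; simp)+
      moreover have "u n \<le> u (r (max K M)) + e / 3" using N n by simp
      ultimately show ?thesis unfolding real_norm_def by linarith
    qed
    then show "\<exists>no. \<forall>n\<ge>no. norm (u n - l) < e" by blast
  qed
  then show ?thesis by (auto simp: convergent_def)
qed

locale subadditive_array =
  fixes e :: "nat \<Rightarrow> int \<Rightarrow> real" and C :: real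
  assumes subadd: "\<bar>x\<bar> \<le> int n \<Longrightarrow> \<bar>y\<bar> \<le> int m \<Longrightarrow> e (n + m) (x + y) \<le> e n x + e m y"
    and bound: "\<bar>x\<bar> \<le> int n \<Longrightarrow> \<bar>e n x\<bar> \<le> C * real n"
begin

lemma multiple:
  assumes "\<bar>y\<bar> \<le> int m"
  shows "e (k * m) (int k * y) \<le> real k * e m y"
proof (induction k)
  case 0
  show ?case using bound[of 0 0] by simp
next
  case (Suc k)
  have "\<bar>int k * y\<bar> \<le> int (k * m)" using assms by (simp add: abs_mult mult_left_mono)
  from subadd[OF assms this] Suc show ?case by (simp add: algebra_simps)
qed

text \<open>Time \<open>n\<close> is filled with \<open>k\<close> blocks of length \<open>m\<close>
  and a rest of length \<open>R\<close> between \<open>t * n\<close> and \<open>2 * t * n\<close>.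
  As \<open>\<bar>\<alpha>\<bar> < 1\<close>, the rest is long enough to make up the displacement
  that the blocks miss. Two sequences \<open>x\<close> and \<open>y\<close> allow limits along
  different endpoints to be compared.\<close>

lemma almost_decreasing:
  fixes x y :: "nat \<Rightarrow> int"
  assumes a: "\<bar>\<alpha>\<bar> < 1" and C: "C > 0"
    and x: "(\<lambda>n. real_of_int (x n) / real n) \<longlonglongrightarrow> \<alpha>" "\<And>n. \<bar>x n\<bar> \<le> int n"
    and y: "(\<lambda>n. real_of_int (y n) / real n) \<longlonglongrightarrow> \<alpha>" "\<And>n. \<bar>y n\<bar> \<le> int n"
    and h: "h > 0"
  shows "\<exists>M. \<forall>m\<ge>M. \<exists>N. \<forall>n\<ge>N. e n (x n) / real n \<le> e m (y m) / real m + h"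
proof -
  \<comment> \<open>The total error is \<open>2 * C * R \<le> 4 * C * t * n\<close>: one half bounds
    the cost of the rest, the other the change from \<open>k * m\<close> to \<open>n\<close> as the
    multiple of the mean block cost.\<close>
  define t where "t = min (1/2) (h / (4 * C))"
  have t: "0 < t" "t \<le> 1/2" "4 * C * t \<le> h" using h C by (auto simp: t_def min_def field_simps)
  \<comment> \<open>Errors of size \<open>d * n\<close> come from \<open>x n\<close> and from the
    \<open>k\<close> blocks; \<open>2 * d * n \<le> (1 - \<bar>\<alpha>\<bar>) * R\<close> keeps the
    missing displacement in the cone of the rest.\<close>
  define d where "d = t * (1 - \<bar>\<alpha>\<bar>) / 2"
  have d: "d > 0" using t a by (simp add: d_def)
  obtain Mx where Mx: "\<And>n. n \<ge> Mx \<Longrightarrow> \<bar>real_of_int (x n) / real n - \<alpha>\<bar> < d"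
    using LIMSEQ_D[OF x(1) d] by auto
  obtain My where My: "\<And>n. n \<ge> My \<Longrightarrow> \<bar>real_of_int (y n) / real n - \<alpha>\<bar> < d"
    using LIMSEQ_D[OF y(1) d] by auto
  have "\<exists>N. \<forall>n\<ge>N. e n (x n) / real n \<le> e m (y m) / real m + h" if m: "m \<ge> max 1 My" for m
  proof -
    \<comment> \<open>Ensures \<open>m \<le> t * n\<close>: rounding \<open>k\<close> down then
      lengthens the rest by at most \<open>t * n\<close>.\<close>
    define N where "N = max (max 1 Mx) (nat \<lceil>real m / t\<rceil>)"
    have "e n (x n) / real n \<le> e m (y m) / real m + h" if n: "n \<ge> N" for n
    proof -
      have m0: "real m > 0" and n0: "real n > 0" using m n by (auto simp: N_def)
      have "real m / t \<le> real n" using n unfolding N_def by linarith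
      then have mn: "real m \<le> t * real n" using t by (simp add: field_simps)
      define k where "k = nat \<lfloor>(1 - t) * real n / real m\<rfloor>"
      have q0: "0 \<le> (1 - t) * real n / real m" using t m0 n0 by simp
      have k: "real k \<le> (1 - t) * real n / real m" "(1 - t) * real n / real m < real k + 1"
        unfolding k_def using q0 by linarith+
      have km: "real k * real m \<le> (1 - t) * real n" "(1 - t) * real n < real k * real m + real m"
        using k m0 by (simp_all add: field_simps)
      have "(1 - t) * real n \<le> 1 * real n" using t by (intro mult_right_mono) auto
      then have kmn: "real (k * m) \<le> real n" using km(1) by simp
      then have kmn': "k * m \<le> n" by (simp only: of_nat_le_iff)
      define R where "R = n - k * m"
      have nR: "n = k * m + R" using kmn' by (simp add: R_def)
      have R: "t * real n \<le> real R" "real R \<le> 2 * t * real n"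
        using km mn kmn' by (simp_all add: R_def of_nat_diff algebra_simps)
      have "\<bar>real_of_int (x n) - \<alpha> * real n\<bar> = real n * \<bar>real_of_int (x n) / real n - \<alpha>\<bar>"
        using n0 by (simp add: field_simps flip: abs_mult_pos')
      also have "\<dots> \<le> real n * d" using Mx[of n] n n0 by (intro mult_left_mono) (auto simp: N_def)
      finally have ex: "\<bar>real_of_int (x n) - \<alpha> * real n\<bar> \<le> d * real n" by (simp add: mult.commute)
      have "\<bar>real_of_int (y m) - \<alpha> * real m\<bar> = real m * \<bar>real_of_int (y m) / real m - \<alpha>\<bar>"
        using m0 by (simp add: field_simps flip: abs_mult_pos')
      also have "\<dots> \<le> real m * d" using My[of m] m m0 by (intro mult_left_mono) auto
      finally have "real k * \<bar>real_of_int (y m) - \<alpha> * real m\<bar> \<le> real k * (real m * d)"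
        by (intro mult_left_mono) auto
      also have "\<dots> = real (k * m) * d" by simp
      also have "\<dots> \<le> real n * d" using kmn d by (intro mult_right_mono) auto
      finally have ey': "real k * \<bar>real_of_int (y m) - \<alpha> * real m\<bar> \<le> d * real n"
        by (simp add: mult.commute)
      have "real k * real_of_int (y m) - \<alpha> * real (k * m) = real k * (real_of_int (y m) - \<alpha> * real m)"
        by (simp add: algebra_simps)
      then have ey: "\<bar>real k * real_of_int (y m) - \<alpha> * real (k * m)\<bar> \<le> d * real n"
        using ey' by (simp add: abs_mult)
      have "\<bar>\<alpha> * real R\<bar> = \<bar>\<alpha>\<bar> * real R" by (simp add: abs_mult)
      moreover have "2 * d * real n \<le> (1 - \<bar>\<alpha>\<bar>) * real R"
      proof -
        have "2 * d * real n = (1 - \<bar>\<alpha>\<bar>) * (t * real n)" by (simp add: d_def)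
        also have "\<dots> \<le> (1 - \<bar>\<alpha>\<bar>) * real R" using R(1) a by (intro mult_left_mono) auto
        finally show ?thesis .
      qed
      moreover have "real n = real (k * m) + real R" using nR by (metis of_nat_add)
      then have "\<alpha> * real n = \<alpha> * real (k * m) + \<alpha> * real R" by (simp only: distrib_left)
      ultimately have "\<bar>real_of_int (x n) - real k * real_of_int (y m)\<bar> \<le> real R"
        using ex ey by (simp add: left_diff_distrib)
      then have xR: "\<bar>x n - int k * y m\<bar> \<le> int R"
        by (metis (mono_tags, opaque_lifting) of_int_abs of_int_diff of_int_le_iff of_int_mult of_int_of_nat_eq)
      have ky: "\<bar>int k * y m\<bar> \<le> int (k * m)" using y(2)[of m] by (simp add: abs_mult mult_left_mono)
      have "e n (x n) = e (k * m + R) (int k * y m + (x n - int k * y m))" using nR by simp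
      also have "\<dots> \<le> e (k * m) (int k * y m) + e R (x n - int k * y m)" by (rule subadd[OF ky xR])
      also have "\<dots> \<le> real k * e m (y m) + C * real R"
        using multiple[OF y(2), of k m] bound[OF xR] by linarith
      also have "real k * e m (y m) = (real n - real R) * (e m (y m) / real m)"
        using m0 nR by simp
      also have "\<dots> = real n * (e m (y m) / real m) - real R * (e m (y m) / real m)"
        by (rule left_diff_distrib)
      also have "- (real R * (e m (y m) / real m)) \<le> real R * C"
      proof -
        have "- (e m (y m) / real m) \<le> C" using bound[OF y(2), of m] m0 by (simp add: field_simps)
        from mult_left_mono[OF this, of "real R"] show ?thesis by simp
      qed
      then have "real n * (e m (y m) / real m) - real R * (e m (y m) / real m) + C * real R
          \<le> real n * (e m (y m) / real m) + 2 * C * real R" by (simp add: algebra_simps)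
      finally have "e n (x n) \<le> real n * (e m (y m) / real m) + 2 * C * real R" .
      also have "2 * C * real R \<le> 2 * C * (2 * t * real n)" using R C by (intro mult_left_mono) auto
      also have "\<dots> = 4 * C * t * real n" by simp
      also have "\<dots> \<le> h * real n" using t n0 by (intro mult_right_mono) auto
      finally show ?thesis using n0 by (simp add: field_simps)
    qed
    then show ?thesis by blast
  qed
  then show ?thesis by blast
qed

text \<open>Applying \<open>almost_decreasing\<close> with the two sequences in either order shows
  that the limit depends on \<open>\<alpha>\<close> alone. Convexity relies on this, since there the
  endpoint is a sum of two integer parts.\<close>

lemma limit_exists:
  assumes a: "\<bar>\<alpha>\<bar> < 1" and C: "C > 0"
  obtains l where "\<And>x :: nat \<Rightarrow> int. (\<lambda>n. real_of_int (x n) / real n) \<longlonglongrightarrow> \<alpha> \<Longrightarrow>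
    (\<And>n. \<bar>x n\<bar> \<le> int n) \<Longrightarrow> (\<lambda>n. e n (x n) / real n) \<longlonglongrightarrow> l"
proof -
  have conv: "convergent (\<lambda>n. e n (x n) / real n)"
    if x: "(\<lambda>n. real_of_int (x n) / real n) \<longlonglongrightarrow> \<alpha>" "\<And>n. \<bar>x n\<bar> \<le> int n" for x :: "nat \<Rightarrow> int"
  proof (rule convergent_if_almost_decreasing)
    show "\<bar>e n (x n) / real n\<bar> \<le> C" for n
      using bound[OF x(2), of n] C by (cases "n = 0") (auto simp: field_simps)
    show "\<exists>M. \<forall>m\<ge>M. \<exists>N. \<forall>n\<ge>N. e n (x n) / real n \<le> e m (x m) / real m + h" if "h > 0" for h
      using almost_decreasing[OF a C x x that] .
  qed
  have le: "lim (\<lambda>n. e n (x n) / real n) \<le> lim (\<lambda>n. e n (y n) / real n)"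
    if x: "(\<lambda>n. real_of_int (x n) / real n) \<longlonglongrightarrow> \<alpha>" "\<And>n. \<bar>x n\<bar> \<le> int n"
      and y: "(\<lambda>n. real_of_int (y n) / real n) \<longlonglongrightarrow> \<alpha>" "\<And>n. \<bar>y n\<bar> \<le> int n" for x y :: "nat \<Rightarrow> int"
  proof (rule field_le_epsilon)
    fix h :: real assume h: "h > 0"
    let ?lx = "lim (\<lambda>n. e n (x n) / real n)" and ?ly = "lim (\<lambda>n. e n (y n) / real n)"
    have lx: "(\<lambda>n. e n (x n) / real n) \<longlonglongrightarrow> ?lx" and ly: "(\<lambda>n. e n (y n) / real n) \<longlonglongrightarrow> ?ly"
      using conv[OF x] conv[OF y] by (simp_all add: convergent_LIMSEQ_iff)
    obtain M where M: "\<And>m. m \<ge> M \<Longrightarrow> \<exists>N. \<forall>n\<ge>N. e n (x n) / real n \<le> e m (y m) / real m + h"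
      using almost_decreasing[OF a C x y h] by blast
    have "?lx \<le> e m (y m) / real m + h" if "m \<ge> M" for m
      using M[OF that] by (intro LIMSEQ_le_const2[OF lx]) auto
    then show "?lx \<le> ?ly + h" using tendsto_add[OF ly tendsto_const[of h]]
      by (intro LIMSEQ_le_const[of "\<lambda>m. e m (y m) / real m + h"]) auto
  qed
  define x0 where "x0 n = intpart (\<alpha> * real n)" for n :: nat
  have x0: "(\<lambda>n. real_of_int (x0 n) / real n) \<longlonglongrightarrow> \<alpha>" "\<And>n. \<bar>x0 n\<bar> \<le> int n"
    unfolding x0_def using a by (intro intpart_ratio_tendsto abs_intpart_le_nat; auto)+
  have "(\<lambda>n. e n (x n) / real n) \<longlonglongrightarrow> lim (\<lambda>n. e n (x0 n) / real n)"
    if x: "(\<lambda>n. real_of_int (x n) / real n) \<longlonglongrightarrow> \<alpha>" "\<And>n. \<bar>x n\<bar> \<le> int n" for x :: "nat \<Rightarrow> int"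
    using conv[OF x] le[OF x x0] le[OF x0 x] by (simp add: convergent_LIMSEQ_iff)
  then show ?thesis by (rule that)
qed

end

section \<open>The random environment\<close>

text \<open>Clipping does not change the environment almost surely; it makes its bounds hold for every
  sample, as the bounded differences inequality requires.\<close>
definition clip :: "real \<Rightarrow> real \<Rightarrow> real" where
  "clip a y = max (- a) (min a y)"

lemma abs_clip_le: "0 \<le> a \<Longrightarrow> \<bar>clip a y\<bar> \<le> a"
  by (auto simp: clip_def)

lemma clip_eq: "\<bar>y\<bar> \<le> a \<Longrightarrow> clip a y = y"
  by (auto simp: clip_def)

lemma clip_measurable [measurable]: "clip a \<in> borel_measurable borel"
  unfolding clip_def by measurable

text \<open>The sum of \<open>exp (- s * action)\<close> over all lazy walks from 0 to
  \<open>x\<close>, in transfer form: the newest sign occurs in the outer factor alone and can be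
  averaged with everything else fixed.\<close>

fun partition_function :: "real \<Rightarrow> (int \<Rightarrow> real) \<Rightarrow> (int \<Rightarrow> real) \<Rightarrow> nat \<Rightarrow> int \<Rightarrow> real" where
  "partition_function s b f 0 x = (if x = 0 then 1 else 0)"
| "partition_function s b f (Suc n) x = exp (- s * (b (int (Suc n)) * f x)) *
     (partition_function s b f n (x - 1) + partition_function s b f n x + partition_function s b f n (x + 1))"

lemma partition_function_nonneg: "0 \<le> partition_function s b f n x"
  by (induction n arbitrary: x) auto

lemma partition_function_cong:
  assumes "\<And>i. i \<le> int n \<Longrightarrow> b i = b' i"
  shows "partition_function s b f n x = partition_function s b' f n x"
  using assms by (induction n arbitrary: x) auto

lemma exp_action_le_partition_function:
  assumes "\<gamma> \<in> lazy_walks 0 0 n x" "i \<le> n"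
  shows "exp (- s * action b f 0 i \<gamma>) \<le> partition_function s b f i (\<gamma> i)"
  using assms(2)
proof (induction i)
  case 0
  then show ?case using assms(1) by (simp add: action_def lazy_walks_def)
next
  case (Suc i)
  let ?Z = "partition_function s b f i"
  have "\<bar>\<gamma> (Suc i) - \<gamma> i\<bar> \<le> 1" using assms(1) Suc.prems by (simp add: lazy_walks_def)
  then have "\<gamma> i = \<gamma> (Suc i) - 1 \<or> \<gamma> i = \<gamma> (Suc i) \<or> \<gamma> i = \<gamma> (Suc i) + 1" by linarith
  then have "?Z (\<gamma> i) \<le> ?Z (\<gamma> (Suc i) - 1) + ?Z (\<gamma> (Suc i)) + ?Z (\<gamma> (Suc i) + 1)"
    using partition_function_nonneg[of s b f i] by (smt (verit))
  then have "exp (- s * action b f 0 i \<gamma>) \<le> ?Z (\<gamma> (Suc i) - 1) + ?Z (\<gamma> (Suc i)) + ?Z (\<gamma> (Suc i) + 1)"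
    using Suc by simp
  then have "exp (- s * (b (int (Suc i)) * f (\<gamma> (Suc i)))) * exp (- s * action b f 0 i \<gamma>)
     \<le> partition_function s b f (Suc i) (\<gamma> (Suc i))"
    by (simp add: mult_left_mono)
  then show ?case by (simp add: action_def algebra_simps flip: exp_add)
qed

text \<open>Mass near both ends of \<open>{-c..c}\<close> provides the pairs in which a walk can
  commute. The mean is that of the clipped sign because the environment is built from clipped
  values.\<close>

locale random_environment =
  fixes c :: real and \<mu> \<nu> :: "real measure"
  assumes c: "0 < c"
    and mu: "prob_space \<mu>" "sets \<mu> = sets borel" and nu: "prob_space \<nu>" "sets \<nu> = sets borel"
    and nu_mean: "(\<integral>y. clip 1 y \<partial>\<nu>) = 0" and nu_sign: "AE y in \<nu>. y = 1 \<or> y = -1"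
    and mu_high: "\<And>e. 0 < e \<Longrightarrow> 0 < measure \<mu> {c - e..}"
    and mu_low: "\<And>e. 0 < e \<Longrightarrow> 0 < measure \<mu> {..- (c - e)}"
begin

text \<open>Sites (\<open>Inl\<close>) and times (\<open>Inr\<close>) index a single product, so
  that shifts, reflection and resampling act on one family of coordinates.\<close>

definition D :: "int + int \<Rightarrow> real measure" where
  "D = case_sum (\<lambda>_. \<mu>) (\<lambda>_. \<nu>)"

definition P :: "(int + int \<Rightarrow> real) measure" where
  "P = PiM UNIV D"

definition bE :: "(int + int \<Rightarrow> real) \<Rightarrow> int \<Rightarrow> real" where
  "bE w i = clip 1 (w (Inr i))"

definition fE :: "(int + int \<Rightarrow> real) \<Rightarrow> int \<Rightarrow> real" where
  "fE w x = clip c (w (Inl x))"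

definition A :: "nat \<Rightarrow> int \<Rightarrow> (int + int \<Rightarrow> real) \<Rightarrow> real" where
  "A n x w = min_action0 (bE w) (fE w) n x"

definition A' :: "nat \<Rightarrow> nat \<Rightarrow> int \<Rightarrow> (int + int \<Rightarrow> real) \<Rightarrow> real" where
  "A' L n x w = min_capped c L (bE w) (fE w) n x"

definition e :: "nat \<Rightarrow> int \<Rightarrow> real" where
  "e n x = (\<integral>w. A n x w \<partial>P)"

lemma D_prob: "prob_space (D j)"
  using mu nu by (cases j) (auto simp: D_def)

lemma sets_D [measurable_cong]: "sets (D j) = sets borel"
  using mu nu by (cases j) (auto simp: D_def)

lemma space_D: "space (D j) = UNIV"
  using sets_eq_imp_space_eq[OF sets_D] by simp

sublocale P: prob_space P
  unfolding P_def by (intro prob_space_PiM D_prob)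

lemma space_P [simp]: "space P = UNIV"
  by (simp add: P_def space_PiM space_D)

lemma prob_UNIV [simp]: "measure P UNIV = 1"
  using P.prob_space by simp

lemma component_measurable [measurable]: "(\<lambda>w. w j) \<in> borel_measurable P"
proof -
  have "(\<lambda>w. w j) \<in> measurable P (D j)"
    unfolding P_def by (rule measurable_component_singleton) simp
  then show ?thesis using measurable_cong_sets[OF refl sets_D] by blast
qed

lemma bE_measurable [measurable]: "(\<lambda>w. bE w i) \<in> borel_measurable P"
  unfolding bE_def by measurable

lemma fE_measurable [measurable]: "(\<lambda>w. fE w x) \<in> borel_measurable P"
  unfolding fE_def by measurable

lemma abs_bE: "\<bar>bE w i\<bar> \<le> 1" by (simp add: bE_def abs_clip_le)

lemma abs_fE: "\<bar>fE w i\<bar> \<le> c" using c by (simp add: fE_def abs_clip_le)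

lemma A_measurable [measurable]: "A n x \<in> borel_measurable P"
proof -
  have "(\<lambda>w. Min ((\<lambda>\<gamma>. action (bE w) (fE w) 0 n \<gamma>) ` walks n x)) \<in> borel_measurable P"
    by (intro borel_measurable_Min finite_walks) (simp add: action_def)
  then show ?thesis unfolding A_def min_action0_eq .
qed

lemma A'_measurable [measurable]: "A' L n x \<in> borel_measurable P"
proof -
  have "(\<lambda>w. Min ((\<lambda>\<gamma>. capped_action c L (bE w) (fE w) n \<gamma>) ` walks n x)) \<in> borel_measurable P"
    by (intro borel_measurable_Min finite_walks) (simp add: capped_action_def)
  then show ?thesis unfolding A'_def min_capped_def .
qed

lemma abs_A: "\<bar>x\<bar> \<le> int n \<Longrightarrow> \<bar>A n x w\<bar> \<le> c * real n"
  unfolding A_def using abs_bE abs_fE by (rule abs_min_action0_le)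

lemma abs_A': "\<bar>x\<bar> \<le> int n \<Longrightarrow> \<bar>A' L n x w\<bar> \<le> c * real n"
  unfolding A'_def using abs_bE abs_fE by (rule abs_min_capped_le)

lemma A_integrable: "\<bar>x\<bar> \<le> int n \<Longrightarrow> integrable P (A n x)"
  by (rule P.integrable_const_bound[where B = "c * real n"]) (use abs_A in auto)

lemma A'_integrable: "\<bar>x\<bar> \<le> int n \<Longrightarrow> integrable P (A' L n x)"
  by (rule P.integrable_const_bound[where B = "c * real n"]) (use abs_A' in auto)

section \<open>Symmetries and sign of the mean action\<close>

lemma reindex:
  assumes inj: "inj \<sigma>" and D: "\<And>j. D (\<sigma> j) = D j"
  shows "(\<lambda>w. w \<circ> \<sigma>) \<in> measurable P P" and "distr P P (\<lambda>w. w \<circ> \<sigma>) = P"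
proof -
  show "distr P P (\<lambda>w. w \<circ> \<sigma>) = P"
    using distr_PiM_reindex[of UNIV D \<sigma> UNIV] inj D_prob by (simp add: P_def D comp_def restrict_def)
  show "(\<lambda>w. w \<circ> \<sigma>) \<in> measurable P P"
    unfolding P_def
  proof (rule measurable_PiM_single')
    show "(\<lambda>w. (w \<circ> \<sigma>) j) \<in> measurable (PiM UNIV D) (D j)" for j
      using measurable_component_singleton[of "\<sigma> j" UNIV D] by (simp add: D)
  qed (auto simp: space_PiM space_D)
qed

lemma integral_reindex:
  assumes "inj \<sigma>" "\<And>j. D (\<sigma> j) = D j" and g: "g \<in> borel_measurable P"
  shows "(\<integral>w. g (w \<circ> \<sigma>) \<partial>P) = (\<integral>w. (g w :: real) \<partial>P)"
proof -
  have "(\<integral>w. g w \<partial>P) = (\<integral>w. g w \<partial>(distr P P (\<lambda>w. w \<circ> \<sigma>)))"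
    using reindex(2)[OF assms(1,2)] by simp
  also have "\<dots> = (\<integral>w. g (w \<circ> \<sigma>) \<partial>P)" by (rule integral_distr[OF reindex(1)[OF assms(1,2)] g])
  finally show ?thesis by simp
qed

lemma e_subadd:
  assumes x: "\<bar>x\<bar> \<le> int n" and y: "\<bar>y\<bar> \<le> int m"
  shows "e (n + m) (x + y) \<le> e n x + e m y"
proof -
  \<comment> \<open>\<open>w \<circ> \<sigma>\<close> is the environment seen from the space-time
    point \<open>(n, x)\<close>.\<close>
  define \<sigma> :: "int + int \<Rightarrow> int + int" where "\<sigma> = map_sum (\<lambda>z. z + x) (\<lambda>i. i + int n)"
  have inj: "inj \<sigma>" unfolding \<sigma>_def by (intro sum.inj_map) (auto intro: injI)
  have D: "D (\<sigma> j) = D j" for j by (cases j) (auto simp: \<sigma>_def D_def)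
  have "A (n + m) (x + y) w \<le> A n x w + A m y (w \<circ> \<sigma>)" for w
    using min_action0_subadditive[OF x y, of "bE w" "fE w"]
    by (simp add: A_def bE_def[abs_def] fE_def[abs_def] \<sigma>_def)
  moreover have xy: "\<bar>x + y\<bar> \<le> int (n + m)" using x y by simp
  moreover have i: "integrable P (\<lambda>w. A m y (w \<circ> \<sigma>))"
    using abs_A[OF y] by (intro P.integrable_const_bound[where B = "c * real m"] AE_I2)
       (auto intro: measurable_compose[OF reindex(1)[OF inj D]])
  ultimately have "e (n + m) (x + y) \<le> (\<integral>w. A n x w + A m y (w \<circ> \<sigma>) \<partial>P)"
    unfolding e_def using x by (intro integral_mono A_integrable Bochner_Integration.integrable_add) auto
  also have "\<dots> = e n x + (\<integral>w. A m y (w \<circ> \<sigma>) \<partial>P)"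
    unfolding e_def using A_integrable[OF x] i by (rule Bochner_Integration.integral_add)
  also have "(\<integral>w. A m y (w \<circ> \<sigma>) \<partial>P) = e m y"
    unfolding e_def using inj D by (intro integral_reindex) auto
  finally show ?thesis .
qed

lemma e_reflect:
  assumes x: "\<bar>x\<bar> \<le> int n"
  shows "e n (- x) = e n x"
proof -
  define \<sigma> :: "int + int \<Rightarrow> int + int" where "\<sigma> = map_sum uminus id"
  have inj: "inj \<sigma>" unfolding \<sigma>_def by (intro sum.inj_map) (auto intro: injI)
  have D: "D (\<sigma> j) = D j" for j by (cases j) (auto simp: \<sigma>_def D_def)
  have "A n (- x) (w \<circ> \<sigma>) = A n x w" for w
    using min_action0_reflect[OF x, of "bE w" "fE w"]
    by (simp add: A_def bE_def[abs_def] fE_def[abs_def] \<sigma>_def)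
  then show ?thesis
    unfolding e_def using integral_reindex[of \<sigma> "A n (- x)", OF inj D] by simp
qed

lemma abs_e:
  assumes "\<bar>x\<bar> \<le> int n" shows "\<bar>e n x\<bar> \<le> c * real n"
proof -
  have "\<bar>e n x\<bar> \<le> (\<integral>w. \<bar>A n x w\<bar> \<partial>P)" unfolding e_def by (rule integral_abs_bound)
  also have "\<dots> \<le> (\<integral>w. c * real n \<partial>P)"
    using abs_A[OF assms] A_integrable[OF assms] by (intro integral_mono) auto
  finally show ?thesis by simp
qed

lemma expectation_bf: "(\<integral>w. bE w i * fE w x \<partial>P) = 0"
proof -
  have bd: "\<bar>bE w i * fE w x\<bar> \<le> 1 * c" for w
    unfolding abs_mult using abs_bE abs_fE by (intro mult_mono) auto
  have "(\<lambda>w. bE w i * fE w x) \<in> borel_measurable (PiM UNIV D)"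
    using borel_measurable_times[OF bE_measurable fE_measurable] by (simp add: P_def)
  from integral_PiM_resample[OF D_prob this bd, of "Inr i"]
  have "(\<integral>w. bE w i * fE w x \<partial>P) = (\<integral>w. (\<integral>y. clip 1 y * fE w x \<partial>\<nu>) \<partial>P)"
    unfolding P_def by (simp add: bE_def fE_def D_def)
  also have "\<dots> = 0" using nu_mean by simp
  finally show ?thesis .
qed

text \<open>Any fixed walk competes, and its action has mean 0 because the signs are centred and
  independent of the sites. This becomes nonnegativity of the limit shape.\<close>

lemma e_nonpos:
  assumes x: "\<bar>x\<bar> \<le> int n" shows "e n x \<le> 0"
proof -
  obtain \<gamma> where \<gamma>: "\<gamma> \<in> walks n x" using walks_nonempty[OF x] by blast
  have int: "integrable P (\<lambda>w. bE w i * fE w y)" for i y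
  proof (rule P.integrable_const_bound[where B = "1 * c"])
    show "AE w in P. norm (bE w i * fE w y) \<le> 1 * c"
      unfolding real_norm_def abs_mult using abs_bE abs_fE by (intro AE_I2 mult_mono) auto
  qed measurable
  have "A n x w \<le> action (bE w) (fE w) 0 n \<gamma>" for w
    unfolding A_def using \<gamma> by (intro min_action0_le) (simp add: walks_def)
  then have "e n x \<le> (\<integral>w. action (bE w) (fE w) 0 n \<gamma> \<partial>P)"
    unfolding e_def using x int by (intro integral_mono A_integrable) (auto simp: action_def)
  also have "\<dots> = 0" unfolding action_def by (simp add: int expectation_bf)
  finally show ?thesis .
qed

subsection \<open>The endpoints of the velocity range\<close>

sublocale subadditive_array e c
  by unfold_locales (use e_subadd abs_e in auto)

lemma partition_function_measurable [measurable]: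
  "(\<lambda>w. partition_function s (bE w) (fE w) n x) \<in> borel_measurable P"
proof (induction n arbitrary: x)
  case (Suc n)
  note [measurable] = Suc
  show ?case by simp
qed simp

text \<open>With the site value frozen, the product is centred in \<open>{-c..c}\<close>, so
  Hoeffding's lemma gives the exponent \<open>s^2 * (2 * c)^2 / 8\<close>.\<close>

lemma exponential_moment_bf:
  assumes s: "s > 0"
  shows "(\<integral>\<^sup>+y. exp (- s * (clip 1 y * fE w x)) \<partial>\<nu>) \<le> ennreal (exp (s\<^sup>2 * c\<^sup>2 / 2))"
proof -
  interpret N: prob_space \<nu> by (rule nu)
  have bd: "\<bar>- (clip 1 y * fE w x)\<bar> \<le> 1 * c" for y
    unfolding abs_minus abs_mult using abs_fE abs_clip_le[of 1] by (intro mult_mono) auto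
  have in_int: "- (clip 1 y * fE w x) \<in> {-c..c}" for y
    using bd[of y] unfolding atLeastAtMost_iff by linarith
  interpret I: interval_bounded_random_variable \<nu> "\<lambda>y. - (clip 1 y * fE w x)" "-c" c
  proof
    have "(\<lambda>y. - (clip 1 y * fE w x)) \<in> borel_measurable borel" by measurable
    then show "(\<lambda>y. - (clip 1 y * fE w x)) \<in> borel_measurable \<nu>"
      using measurable_cong_sets[OF nu(2) refl] by blast
  qed (use in_int in simp)
  have "(\<integral>y. - (clip 1 y * fE w x) \<partial>\<nu>) = 0" using nu_mean by simp
  from I.Hoeffdings_lemma_nn_integral_0[OF s this] show ?thesis
    by (simp add: power2_eq_square mult_ac)
qed

text \<open>The weight \<open>exp (- \<theta> * x)\<close> is an eigenfunction of the sum over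
  steps, with eigenvalue \<open>exp \<theta> + 1 + exp (- \<theta>) \<le> exp (\<theta> + 2 * exp (-
  \<theta>))\<close>. Each step adds the moment factor of a fresh sign; repeated visits do no harm,
  as the field stays fixed. Apart from that factor,
  \<open>\<theta> * (n - x) + 2 * n * exp (- \<theta>)\<close> bounds the logarithm of the number of
  walks; a large \<open>\<theta>\<close> makes it small compared to \<open>n\<close> when
  \<open>x\<close> is near \<open>n\<close>.\<close>

lemma expectation_partition_function:
  assumes s: "s > 0" and th: "\<theta> \<ge> 0"
  shows "(\<integral>\<^sup>+w. partition_function s (bE w) (fE w) n x \<partial>P)
    \<le> ennreal (exp (- \<theta> * real_of_int x + real n * (\<theta> + 2 * exp (- \<theta>) + s\<^sup>2 * c\<^sup>2 / 2)))"
proof (induction n arbitrary: x)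
  case 0
  show ?case by (simp add: P.emeasure_space_1[simplified])
next
  case (Suc n)
  define a where "a = \<theta> + 2 * exp (- \<theta>) + s\<^sup>2 * c\<^sup>2 / 2"
  let ?Z = "\<lambda>w x. partition_function s (bE w) (fE w) n x"
  let ?G = "\<lambda>w. ?Z w (x - 1) + ?Z w x + ?Z w (x + 1)"
  \<comment> \<open>The sign at time \<open>n + 1\<close>, which \<open>?Z\<close> does not read, so
    it can be resampled with the past and the field fixed.\<close>
  let ?j = "Inr (int (Suc n)) :: int + int"
  have f_upd: "fE (w(?j := y)) = fE w" for w y by (simp add: fE_def fun_eq_iff)
  have Z_upd: "?Z (w(?j := y)) z = ?Z w z" for w y z
    unfolding f_upd by (rule partition_function_cong) (auto simp: bE_def)
  have Z_Suc: "partition_function s (bE (w(?j := y))) (fE (w(?j := y))) (Suc n) x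
      = ?G w * exp (- s * (clip 1 y * fE w x))" for w y
    unfolding partition_function.simps Z_upd by (simp only: f_upd) (simp add: bE_def mult.commute)
  have G0: "0 \<le> ?G w" for w by (simp add: partition_function_nonneg)
  have m: "(\<lambda>w. ennreal (partition_function s (bE w) (fE w) (Suc n) x)) \<in> borel_measurable (PiM UNIV D)"
    using measurable_compose[OF partition_function_measurable measurable_ennreal, of s "Suc n" x] unfolding P_def .
  have em: "(\<lambda>y. ennreal (exp (- s * (clip 1 y * fE w x)))) \<in> borel_measurable \<nu>" for w
    by (subst measurable_cong_sets[OF nu(2) refl]) measurable
  have "(\<integral>\<^sup>+w. partition_function s (bE w) (fE w) (Suc n) x \<partial>P)
      = (\<integral>\<^sup>+w. (\<integral>\<^sup>+y. partition_function s (bE (w(?j := y))) (fE (w(?j := y))) (Suc n) x \<partial>(D ?j)) \<partial>P)"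
    unfolding P_def by (rule nn_integral_PiM_resample[OF D_prob m])
  also have "\<dots> = (\<integral>\<^sup>+w. (\<integral>\<^sup>+y. ennreal (?G w) * ennreal (exp (- s * (clip 1 y * fE w x))) \<partial>\<nu>) \<partial>P)"
    unfolding Z_Suc using G0 by (simp add: D_def flip: ennreal_mult)
  also have "\<dots> = (\<integral>\<^sup>+w. ennreal (?G w) * (\<integral>\<^sup>+y. ennreal (exp (- s * (clip 1 y * fE w x))) \<partial>\<nu>) \<partial>P)"
    by (intro nn_integral_cong nn_integral_cmult em)
  also have "\<dots> \<le> (\<integral>\<^sup>+w. ennreal (?G w) * ennreal (exp (s\<^sup>2 * c\<^sup>2 / 2)) \<partial>P)"
    by (intro nn_integral_mono mult_left_mono exponential_moment_bf s) auto
  also have "\<dots> = (\<integral>\<^sup>+w. ennreal (?G w) \<partial>P) * ennreal (exp (s\<^sup>2 * c\<^sup>2 / 2))"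
    by (rule nn_integral_multc) measurable
  also have "(\<integral>\<^sup>+w. ennreal (?G w) \<partial>P) = (\<integral>\<^sup>+w. ?Z w (x - 1) \<partial>P) + (\<integral>\<^sup>+w. ?Z w x \<partial>P) + (\<integral>\<^sup>+w. ?Z w (x + 1) \<partial>P)"
    by (simp add: nn_integral_add partition_function_nonneg ennreal_plus del: ennreal_plus[symmetric])
  also have "\<dots> \<le> ennreal (exp (- \<theta> * real_of_int (x - 1) + real n * a))
      + ennreal (exp (- \<theta> * real_of_int x + real n * a)) + ennreal (exp (- \<theta> * real_of_int (x + 1) + real n * a))"
    unfolding a_def by (intro add_mono Suc)
  also have "\<dots> = ennreal (exp (- \<theta> * real_of_int x + real n * a) * (exp \<theta> + 1 + exp (- \<theta>)))"
    by (simp add: algebra_simps flip: ennreal_plus exp_add)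
  also have "\<dots> \<le> ennreal (exp (- \<theta> * real_of_int x + real n * a) * exp (\<theta> + 2 * exp (- \<theta>)))"
  proof (intro ennreal_leI mult_left_mono)
    have "exp (- \<theta>) \<le> 1" using th by simp
    moreover have "exp \<theta> * (1 + 2 * exp (- \<theta>)) = exp \<theta> + 2"
      by (simp add: exp_minus field_simps)
    ultimately have "exp \<theta> + 1 + exp (- \<theta>) \<le> exp \<theta> * (1 + 2 * exp (- \<theta>))" by linarith
    also have "\<dots> \<le> exp \<theta> * exp (2 * exp (- \<theta>))"
      by (intro mult_left_mono exp_ge_add_one_self) auto
    finally show "exp \<theta> + 1 + exp (- \<theta>) \<le> exp (\<theta> + 2 * exp (- \<theta>))" by (simp add: exp_add)
  qed simp
  finally have "(\<integral>\<^sup>+w. partition_function s (bE w) (fE w) (Suc n) x \<partial>P)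
     \<le> ennreal (exp (- \<theta> * real_of_int x + real n * a) * exp (\<theta> + 2 * exp (- \<theta>))) * ennreal (exp (s\<^sup>2 * c\<^sup>2 / 2))"
    by (simp add: mult_right_mono)
  also have "\<dots> = ennreal (exp (- \<theta> * real_of_int x + real (Suc n) * a))"
    by (simp add: a_def algebra_simps flip: ennreal_mult exp_add)
  finally show ?case unfolding a_def .
qed

text \<open>The optimal walk alone contributes \<open>exp (- s * A n x w)\<close> to the partition
  function, so Jensen's inequality turns the moment bound into a bound on the mean. Reflection
  covers negative endpoints.\<close>

lemma e_lower_bound:
  assumes s: "s > 0" and th: "\<theta> \<ge> 0" and x: "\<bar>x\<bar> \<le> int n"
  shows "- e n x \<le> (\<theta> * (real n - \<bar>real_of_int x\<bar>) + real n * (2 * exp (- \<theta>))) / s + real n * s * c\<^sup>2 / 2"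
proof -
  have main: "- e n x \<le> (\<theta> * (real n - real_of_int x) + real n * (2 * exp (- \<theta>))) / s + real n * s * c\<^sup>2 / 2"
    if x: "\<bar>x\<bar> \<le> int n" for x
  proof -
    define K where "K = - \<theta> * real_of_int x + real n * (\<theta> + 2 * exp (- \<theta>) + s\<^sup>2 * c\<^sup>2 / 2)"
    have le: "exp (- s * A n x w) \<le> partition_function s (bE w) (fE w) n x" for w
    proof -
      obtain \<gamma> where \<gamma>: "\<gamma> \<in> walks n x" "A n x w = action (bE w) (fE w) 0 n \<gamma>"
        unfolding A_def using min_action0_attained[OF x] by blast
      then have "\<gamma> \<in> lazy_walks 0 0 n x" "\<gamma> n = x" by (auto simp: walks_def lazy_walks_def)
      then show ?thesis using exp_action_le_partition_function[of \<gamma> n x n s "bE w" "fE w"] \<gamma>(2) by simp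
    qed
    have bd: "- s * A n x w \<le> s * (c * real n)" for w
      using abs_A[OF x, of w] s mult_left_mono[of "- A n x w" "c * real n" s] by simp
    have int: "integrable P (\<lambda>w. exp (- s * A n x w))"
      using bd by (intro P.integrable_const_bound[where B = "exp (s * (c * real n))"]) auto
    have "ennreal (\<integral>w. exp (- s * A n x w) \<partial>P) = (\<integral>\<^sup>+w. exp (- s * A n x w) \<partial>P)"
      using int by (intro nn_integral_eq_integral[symmetric]) auto
    also have "\<dots> \<le> (\<integral>\<^sup>+w. partition_function s (bE w) (fE w) n x \<partial>P)"
      using le by (intro nn_integral_mono ennreal_leI) auto
    also have "\<dots> \<le> ennreal (exp K)"
      unfolding K_def by (rule expectation_partition_function[OF s th])
    finally have E: "(\<integral>w. exp (- s * A n x w) \<partial>P) \<le> exp K" by simp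
    \<comment> \<open>Jensen's inequality for \<open>exp\<close> in tangent form, with the tangent
      at \<open>K\<close>.\<close>
    have "- s * A n x w \<le> K - 1 + exp (- s * A n x w) * exp (- K)" for w
      using exp_ge_add_one_self[of "- s * A n x w - K"] by (simp add: exp_diff exp_minus field_simps)
    then have "(\<integral>w. - s * A n x w \<partial>P) \<le> (\<integral>w. K - 1 + exp (- s * A n x w) * exp (- K) \<partial>P)"
      using int A_integrable[OF x] by (intro integral_mono) auto
    also have "\<dots> = K - 1 + (\<integral>w. exp (- s * A n x w) \<partial>P) * exp (- K)"
      using int by (simp add: Bochner_Integration.integral_add)
    also have "\<dots> \<le> K - 1 + exp K * exp (- K)"
      using E by (intro add_left_mono mult_right_mono) auto
    also have "\<dots> = K" by (simp flip: exp_add)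
    finally have "s * (- e n x) \<le> K" by (simp add: e_def)
    then have "- e n x \<le> K / s" using s by (simp add: field_simps)
    also have "K / s = (\<theta> * (real n - real_of_int x) + real n * (2 * exp (- \<theta>))) / s + real n * s * c\<^sup>2 / 2"
      using s by (simp add: K_def field_simps power2_eq_square)
    finally show ?thesis .
  qed
  show ?thesis
  proof (cases "x \<ge> 0")
    case True then show ?thesis using main[OF x] by simp
  next
    case False
    then show ?thesis using main[of "- x"] x e_reflect[OF x] by simp
  qed
qed

subsection \<open>Concentration\<close>

text \<open>The last position \<open>y + r - 1\<close> for \<open>z\<close> keeps
  \<open>z + 1\<close> within distance \<open>r\<close> of \<open>y\<close>.\<close>

definition pair_near :: "nat \<Rightarrow> real \<Rightarrow> int \<Rightarrow> (int + int \<Rightarrow> real) \<Rightarrow> bool" where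
  "pair_near r \<epsilon> y w \<longleftrightarrow> (\<exists>z\<in>{y - int r..y + int r - 1}. c - \<epsilon> \<le> w (Inl z) \<and> w (Inl (z + 1)) \<le> - (c - \<epsilon>))"

lemma pair_near_measurable [measurable]: "Measurable.pred P (pair_near r \<epsilon> y)"
  unfolding pair_near_def[abs_def] by measurable

lemma not_pair_near_sets: "{w. \<not> pair_near r \<epsilon> y w} \<in> sets P"
proof -
  have "{w \<in> space P. \<not> pair_near r \<epsilon> y w} \<in> sets P" by measurable
  then show ?thesis by simp
qed

lemma deviation_sets: "{w. \<bar>A' L n x w - a\<bar> \<ge> t} \<in> sets P"
proof -
  have "{w \<in> space P. \<bar>A' L n x w - a\<bar> \<ge> t} \<in> sets P" by measurable
  then show ?thesis by simp
qed

text \<open>The pairs starting at \<open>y + 2 * j\<close> are disjoint, hence independent.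
  Resampling the two coordinates of the last pair, one after the other, splits off its
  factor.\<close>

lemma prob_no_pair:
  fixes y :: int and \<epsilon> :: real
  defines "I w j \<equiv> indicator {c - \<epsilon>..} (w (Inl (y + 2 * int j))) * indicator {..- (c - \<epsilon>)} (w (Inl (y + 2 * int j + 1))) :: real"
  shows "(\<integral>w. (\<Prod>j<k. 1 - I w j) \<partial>P)
    = (1 - measure \<mu> {c - \<epsilon>..} * measure \<mu> {..- (c - \<epsilon>)}) ^ k"
proof (induction k)
  case 0
  show ?case by simp
next
  case (Suc k)
  interpret M: prob_space \<mu> by (rule mu)
  have [simp]: "space \<mu> = UNIV" using sets_eq_imp_space_eq[OF mu(2)] by simp
  let ?g = "\<lambda>w. \<Prod>j<k. 1 - I w j"
  let ?u = "Inl (y + 2 * int k + 1) :: int + int" and ?v = "Inl (y + 2 * int k) :: int + int"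
  let ?a = "measure \<mu> {c - \<epsilon>..}" and ?b = "measure \<mu> {..- (c - \<epsilon>)}"
  have [measurable]: "(\<lambda>w. I w j) \<in> borel_measurable P" for j unfolding I_def by measurable
  have I01: "0 \<le> 1 - I w j \<and> 1 - I w j \<le> 1" for w j by (simp add: I_def indicator_def)
  then have g01: "0 \<le> ?g w \<and> ?g w \<le> 1" for w by (auto intro!: prod_nonneg prod_le_1)
  have gu: "?g (w(?u := x)) = ?g w" and gv: "?g (w(?v := x)) = ?g w" for w x
    unfolding I_def by (intro prod.cong refl; auto)+
  have im: "integrable \<mu> (indicator S :: real \<Rightarrow> real)" "(\<integral>x. indicator S x \<partial>\<mu>) = measure \<mu> S" if "S \<in> sets borel" for S
    using that mu(2) by (auto simp: M.emeasure_eq_measure)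
  have m1: "(\<lambda>w. ?g w * (1 - I w k)) \<in> borel_measurable (PiM UNIV D)"
    unfolding P_def[symmetric] by measurable
  have b1: "\<bar>?g w * (1 - I w k)\<bar> \<le> 1" for w
    using g01[of w] I01[of w k] by (auto simp: abs_mult intro!: mult_le_one)
  have m2: "(\<lambda>w. ?g w * (1 - indicator {c - \<epsilon>..} (w ?v) * ?b)) \<in> borel_measurable (PiM UNIV D)"
    unfolding P_def[symmetric] by measurable
  have b2: "\<bar>?g w * (1 - indicator {c - \<epsilon>..} (w ?v) * ?b)\<bar> \<le> 1" for w
    using g01[of w] by (auto simp: abs_mult indicator_def intro!: mult_le_one)
  have "(\<integral>w. (\<Prod>j<Suc k. 1 - I w j) \<partial>P) = (\<integral>w. ?g w * (1 - I w k) \<partial>P)" by simp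
  also have "\<dots> = (\<integral>w. (\<integral>x. ?g w * (1 - indicator {c - \<epsilon>..} (w ?v) * indicator {..- (c - \<epsilon>)} x) \<partial>\<mu>) \<partial>P)"
    unfolding P_def integral_PiM_resample[OF D_prob m1 b1, of ?u] gu by (simp add: D_def I_def)
  also have "\<dots> = (\<integral>w. ?g w * (1 - indicator {c - \<epsilon>..} (w ?v) * ?b) \<partial>P)"
    by (intro Bochner_Integration.integral_cong refl) (simp add: im M.prob_space[simplified] Bochner_Integration.integral_diff)
  also have "\<dots> = (\<integral>w. (\<integral>x. ?g w * (1 - indicator {c - \<epsilon>..} x * ?b) \<partial>\<mu>) \<partial>P)"
    unfolding P_def integral_PiM_resample[OF D_prob m2 b2, of ?v] gv by (simp add: D_def)
  also have "\<dots> = (\<integral>w. ?g w * (1 - ?a * ?b) \<partial>P)"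
    by (intro Bochner_Integration.integral_cong refl) (simp add: im M.prob_space[simplified] Bochner_Integration.integral_diff)
  also have "\<dots> = (1 - ?a * ?b) ^ Suc k" using Suc by (simp add: mult.commute)
  finally show ?case .
qed

text \<open>The window contains \<open>r div 2\<close> disjoint pairs to the right of
  \<open>y\<close>; the other positions are given up for the sake of independence.\<close>

lemma prob_not_pair_near:
  "measure P {w. \<not> pair_near r \<epsilon> y w} \<le> (1 - measure \<mu> {c - \<epsilon>..} * measure \<mu> {..- (c - \<epsilon>)}) ^ (r div 2)"
proof -
  let ?I = "\<lambda>w j. indicator {c - \<epsilon>..} (w (Inl (y + 2 * int j))) * indicator {..- (c - \<epsilon>)} (w (Inl (y + 2 * int j + 1))) :: real"
  have I01: "0 \<le> 1 - ?I w j \<and> 1 - ?I w j \<le> 1" for w j by (simp add: indicator_def)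
  then have pr: "0 \<le> (\<Prod>j<k. 1 - ?I w j) \<and> (\<Prod>j<k. 1 - ?I w j) \<le> 1" for w k
    by (intro conjI prod_nonneg prod_le_1) auto
  note set = not_pair_near_sets[of r \<epsilon> y]
  have le: "indicator {w. \<not> pair_near r \<epsilon> y w} w \<le> (\<Prod>j<r div 2. 1 - ?I w j)" for w
  proof (cases "pair_near r \<epsilon> y w")
    case False
    have "?I w j = 0" if "j < r div 2" for j
    proof -
      have "y + 2 * int j \<in> {y - int r..y + int r - 1}" using that by auto
      then show ?thesis using False unfolding pair_near_def indicator_def by fastforce
    qed
    then have "(\<Prod>j<r div 2. 1 - ?I w j) = 1" by (intro prod.neutral) auto
    then show ?thesis by (simp add: indicator_def)
  next
    case True
    then show ?thesis using pr[of w "r div 2"] by simp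
  qed
  have "measure P {w. \<not> pair_near r \<epsilon> y w} = (\<integral>w. indicator {w. \<not> pair_near r \<epsilon> y w} w \<partial>P)"
    using set by simp
  also have "\<dots> \<le> (\<integral>w. (\<Prod>j<r div 2. 1 - ?I w j) \<partial>P)"
  proof (intro integral_mono le)
    show "integrable P (indicator {w. \<not> pair_near r \<epsilon> y w} :: _ \<Rightarrow> real)"
      using set by (simp add: P.emeasure_eq_measure)
    show "integrable P (\<lambda>w. \<Prod>j<r div 2. 1 - ?I w j)"
    proof (rule P.integrable_const_bound[where B = 1])
      show "AE w in P. norm (\<Prod>j<r div 2. 1 - ?I w j) \<le> 1"
      proof (rule AE_I2)
        show "norm (\<Prod>j<r div 2. 1 - ?I w j) \<le> 1" for w using pr[of w "r div 2"] by simp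
      qed
    qed measurable
  qed
  also have "\<dots> = (1 - measure \<mu> {c - \<epsilon>..} * measure \<mu> {..- (c - \<epsilon>)}) ^ (r div 2)"
    by (rule prob_no_pair)
  finally show ?thesis .
qed

lemma A'_concentration:
  assumes x: "\<bar>x\<bar> \<le> int n" and n: "1 \<le> n" and L: "1 \<le> L" and \<epsilon>: "\<epsilon> > 0"
  shows "measure P {w. \<bar>A' L n x w - (\<integral>w. A' L n x w \<partial>P)\<bar> \<ge> \<epsilon> * real n}
    \<le> 2 * exp (- (\<epsilon>\<^sup>2 * real n / (32 * c\<^sup>2 * (real L)\<^sup>2)))"
proof -
  define J :: "(int + int) set" where "J = Inl ` {- int n..int n} \<union> Inr ` {1..int n}"
  define d :: "int + int \<Rightarrow> real" where "d = case_sum (\<lambda>_. 2 * c * real L) (\<lambda>_. 2 * c)"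
  \<comment> \<open>At most \<open>3 * n\<close> sites contribute \<open>4 * c^2 * L^2\<close> each,
    and \<open>n\<close> signs at most as much each: \<open>12 + 4 = 16\<close>.\<close>
  define S where "S = 16 * c\<^sup>2 * (real L)\<^sup>2 * real n"
  have "S > 0" using c L n by (simp add: S_def)
  have "(\<Sum>j\<in>J. (d j)\<^sup>2) = (\<Sum>j\<in>Inl ` {- int n..int n}. (d j)\<^sup>2) + (\<Sum>j\<in>Inr ` {1..int n}. (d j)\<^sup>2)"
    unfolding J_def by (intro sum.union_disjoint) auto
  also have "\<dots> = real (2 * n + 1) * (2 * c * real L)\<^sup>2 + real n * (2 * c)\<^sup>2"
    by (simp add: sum.reindex d_def)
  also have "\<dots> \<le> real (3 * n) * (2 * c * real L)\<^sup>2 + real n * (2 * c * real L)\<^sup>2"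
    using n L c by (intro add_mono mult_right_mono mult_left_mono power_mono) (auto simp: mult_left_mono)
  also have "\<dots> = S" by (simp add: S_def power_mult_distrib)
  finally have sum: "(\<Sum>j\<in>J. (d j)\<^sup>2) \<le> S" .
  have "measure (PiM UNIV D) {w. \<bar>A' L n x w - (\<integral>w. A' L n x w \<partial>(PiM UNIV D))\<bar> \<ge> \<epsilon> * real n}
     \<le> 2 * exp (- (\<epsilon> * real n)\<^sup>2 / (2 * S))"
  proof (rule bounded_differences_tail)
    show "prob_space (D j)" "space (D j) = UNIV" for j by (rule D_prob space_D)+
    show "finite J" by (simp add: J_def)
    show "A' L n x \<in> borel_measurable (PiM UNIV D)" using A'_measurable unfolding P_def .
    show "\<bar>A' L n x w\<bar> \<le> c * real n" for w by (rule abs_A'[OF x])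
    show "(\<Sum>j\<in>J. (d j)\<^sup>2) \<le> S" by fact
    show "S > 0" by fact
    show "\<epsilon> * real n > 0" using \<epsilon> n by simp
    \<comment> \<open>A walk of length \<open>n\<close> from 0 stays in \<open>{- n..n}\<close>, so
      \<open>J\<close> contains every coordinate it reads.\<close>
    show "A' L n x w = A' L n x w'" if eq: "\<And>j. j \<in> J \<Longrightarrow> w j = w' j" for w w'
    proof -
      have "capped_action c L (bE w) (fE w) n \<gamma> = capped_action c L (bE w') (fE w') n \<gamma>"
        if \<gamma>: "\<gamma> \<in> walks n x" for \<gamma>
        unfolding capped_action_def
      proof (intro sum.cong refl)
        fix i assume i: "i \<in> {1..n}"
        have "\<bar>\<gamma> i\<bar> \<le> int i" using \<gamma> i by (intro lazy_walks_bound[of \<gamma> n x]) (auto simp: walks_def)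
        then have "w (Inl (\<gamma> i)) = w' (Inl (\<gamma> i))" "w (Inr (int i)) = w' (Inr (int i))"
          using i by (intro eq; force simp: J_def)+
        then show "(if L < visits n \<gamma> (\<gamma> i) then - c else bE w (int i) * fE w (\<gamma> i)) =
          (if L < visits n \<gamma> (\<gamma> i) then - c else bE w' (int i) * fE w' (\<gamma> i))"
          by (simp add: bE_def fE_def)
      qed
      then show ?thesis unfolding A'_def min_capped_def by (metis (no_types, lifting) image_cong)
    qed
    show "\<bar>A' L n x (w(j := t)) - A' L n x w\<bar> \<le> d j" for w j t
    proof (cases j)
      case (Inl y)
      have "bE (w(j := t)) = bE w" using Inl by (simp add: bE_def fun_eq_iff)
      moreover have "\<bar>min_capped c L (bE w) (fE (w(j := t))) n x - min_capped c L (bE w) (fE w) n x\<bar> \<le> 2 * c * real L"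
        by (rule min_capped_diff_space[where y = y]) (rule abs_bE abs_fE | simp add: fE_def Inl)+
      ultimately show ?thesis by (simp add: A'_def d_def Inl)
    next
      case (Inr i)
      have "fE (w(j := t)) = fE w" using Inr by (simp add: fE_def fun_eq_iff)
      moreover have "\<bar>min_capped c L (bE (w(j := t))) (fE w) n x - min_capped c L (bE w) (fE w) n x\<bar> \<le> 2 * c"
        by (rule min_capped_diff_time[where k = i]) (rule abs_bE abs_fE | simp add: bE_def Inr)+
      ultimately show ?thesis by (simp add: A'_def d_def Inr)
    qed
  qed
  also have "- (\<epsilon> * real n)\<^sup>2 / (2 * S) = - (\<epsilon>\<^sup>2 * real n / (32 * c\<^sup>2 * (real L)\<^sup>2))"
    using n by (simp add: S_def power_mult_distrib power2_eq_square)
  finally show ?thesis unfolding P_def .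
qed

lemma A_le_A'_of_pairs:
  assumes b: "\<And>i. bE w i = 1 \<or> bE w i = -1" and \<epsilon>: "0 < \<epsilon>" "\<epsilon> \<le> c" and r: "1 \<le> r" and L: "1 \<le> L"
    and pair: "\<And>y. \<bar>y\<bar> \<le> int n \<Longrightarrow> pair_near r \<epsilon> y w" and x: "\<bar>x\<bar> \<le> int n"
  shows "A n x w \<le> A' L n x w + (\<epsilon> + 4 * c * real r / real L) * real n"
  unfolding A_def A'_def
proof (rule min_action0_le_min_capped)
  show "\<exists>z. \<bar>z - y\<bar> \<le> int r \<and> \<bar>z + 1 - y\<bar> \<le> int r \<and> c - \<epsilon> \<le> fE w z \<and> fE w (z + 1) \<le> - (c - \<epsilon>)"
    if y: "\<bar>y\<bar> \<le> int n" for y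
  proof -
    obtain z where "z \<in> {y - int r..y + int r - 1}" "c - \<epsilon> \<le> w (Inl z)" "w (Inl (z + 1)) \<le> - (c - \<epsilon>)"
      using pair[OF y] by (auto simp: pair_near_def)
    \<comment> \<open>\<open>pair_near\<close> speaks of unclipped values; both inequalities survive
      clipping because the thresholds lie in \<open>{-c..c}\<close>.\<close>
    then show ?thesis using \<epsilon> c by (intro exI[of _ z]) (auto simp: fE_def clip_def)
  qed
qed (use assms abs_fE in auto)

lemma A'_le_A: "\<bar>x\<bar> \<le> int n \<Longrightarrow> A' L n x w \<le> A n x w"
  unfolding A_def A'_def by (rule min_capped_le_min_action0[OF abs_bE abs_fE])

section \<open>Choice of scales and almost sure concentration\<close>

lemma bE_sign: "AE w in P. \<forall>i. bE w i = 1 \<or> bE w i = -1"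
proof -
  have "AE w in P. w (Inr i) = 1 \<or> w (Inr i) = -1" for i
  proof -
    have "D (Inr i) = \<nu>" by (simp add: D_def)
    then have "AE y in D (Inr i). y = 1 \<or> y = -1" using nu_sign by (simp only:)
    then show ?thesis unfolding P_def by (intro AE_PiM_component D_prob) auto
  qed
  then have "AE w in P. \<forall>i. w (Inr i) = 1 \<or> w (Inr i) = -1" by (simp add: AE_all_countable)
  then show ?thesis
  proof eventually_elim
    case (elim w)
    have "clip 1 y = 1 \<or> clip 1 y = -1" if "y = 1 \<or> y = -1" for y :: real
      using that by (auto simp: clip_def)
    then show ?case using elim by (simp add: bE_def)
  qed
qed

text \<open>With these exponents \<open>n / cap^2\<close> grows like \<open>n powr (1/2)\<close> and
  the radius like \<open>n powr (1/8)\<close>, so both failure probabilities beat the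
  \<open>2 * n + 1\<close> sites and endpoints, while \<open>radius / cap\<close> decays like
  \<open>n powr (-1/8)\<close>.\<close>

definition cap :: "nat \<Rightarrow> nat" where "cap n = nat \<lceil>real n powr (1/4)\<rceil>"
definition radius :: "nat \<Rightarrow> nat" where "radius n = nat \<lceil>real n powr (1/8)\<rceil>"
text \<open>A union bound over the sites that may lack a nearby pair and over the endpoints whose
  capped action may deviate.\<close>

definition \<beta> :: "real \<Rightarrow> nat \<Rightarrow> real" where
  "\<beta> \<epsilon> n = real (2 * n + 1) * ((1 - measure \<mu> {c - \<epsilon>..} * measure \<mu> {..- (c - \<epsilon>)}) ^ (radius n div 2)
     + 2 * exp (- (\<epsilon>\<^sup>2 * real n / (32 * c\<^sup>2 * (real (cap n))\<^sup>2))))"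

lemma radius_ge_1: "1 \<le> n \<Longrightarrow> 1 \<le> radius n" and cap_ge_1: "1 \<le> n \<Longrightarrow> 1 \<le> cap n"
  by (simp_all add: radius_def cap_def Suc_le_eq)

lemma radius_over_cap: "(\<lambda>n. real (radius n) / real (cap n)) \<longlonglongrightarrow> 0"
proof (rule Lim_null_comparison)
  show "(\<lambda>n. (real n powr (1/8) + 1) / real n powr (1/4)) \<longlonglongrightarrow> 0" by real_asymp
  have "real (radius n) / real (cap n) \<le> (real n powr (1/8) + 1) / real n powr (1/4)" if "n \<ge> 1" for n
    using that by (intro frac_le) (auto simp: radius_def cap_def; linarith)+
  then show "\<forall>\<^sub>F n in sequentially. norm (real (radius n) / real (cap n)) \<le> (real n powr (1/8) + 1) / real n powr (1/4)"
    by (auto intro: eventually_sequentiallyI[of 1])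
qed

lemma summable_\<beta>:
  assumes \<epsilon>: "0 < \<epsilon>"
  shows "summable (\<beta> \<epsilon>)" and "\<beta> \<epsilon> \<longlonglongrightarrow> 0" and "0 \<le> \<beta> \<epsilon> n"
proof -
  interpret M: prob_space \<mu> by (rule mu)
  define q where "q = 1 - measure \<mu> {c - \<epsilon>..} * measure \<mu> {..- (c - \<epsilon>)}"
  have "0 < measure \<mu> {c - \<epsilon>..} * measure \<mu> {..- (c - \<epsilon>)}" "measure \<mu> {c - \<epsilon>..} * measure \<mu> {..- (c - \<epsilon>)} \<le> 1"
    using mu_high[OF \<epsilon>] mu_low[OF \<epsilon>] by (simp_all add: mult_le_one)
  then have q: "0 \<le> q" "q < 1" by (auto simp: q_def)
  show "0 \<le> \<beta> \<epsilon> n" for n using q by (simp add: \<beta>_def q_def)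
  \<comment> \<open>\<open>q\<close> may be 0 when \<open>\<epsilon>\<close> is large, so a positive
    majorant is taken before the logarithm.\<close>
  define q' where "q' = max q (1/2)"
  have q': "0 < q'" "q' < 1" "q \<le> q'" using q by (auto simp: q'_def)
  define a where "a = - ln q' / 2"
  have a: "a > 0" using q' by (simp add: a_def)
  define d where "d = \<epsilon>\<^sup>2 / (32 * c\<^sup>2)"
  have d: "d > 0" using \<epsilon> c by (simp add: d_def)
  \<comment> \<open>A majorant free of ceilings and integer halving, whose decay is
    explicit.\<close>
  define h where "h n = real (2 * n + 1) * (exp (- a * (real n powr (1/8) - 1))
      + 2 * exp (- d * real n / (real n powr (1/4) + 1)\<^sup>2))" for n :: nat
  have le: "\<beta> \<epsilon> n \<le> h n" if n: "n \<ge> 1" for n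
  proof -
    have "q ^ (radius n div 2) \<le> q' ^ (radius n div 2)" using q q' by (intro power_mono) auto
    also have "\<dots> = exp (ln q' * real (radius n div 2))"
      using q' by (simp add: exp_of_nat2_mult mult.commute)
    also have "\<dots> \<le> exp (- a * (real n powr (1/8) - 1))"
    proof -
      have "real n powr (1/8) \<le> real (radius n)" unfolding radius_def by linarith
      moreover have "real (radius n) - 1 \<le> 2 * real (radius n div 2)" by linarith
      ultimately have "real n powr (1/8) - 1 \<le> 2 * real (radius n div 2)" by linarith
      then have "a * (real n powr (1/8) - 1) \<le> a * (2 * real (radius n div 2))" using a by (intro mult_left_mono) auto
      then show ?thesis by (simp add: a_def)
    qed
    finally have 1: "q ^ (radius n div 2) \<le> exp (- a * (real n powr (1/8) - 1))" .
    have "real (cap n) \<le> real n powr (1/4) + 1" "1 \<le> cap n" using cap_ge_1[OF n] unfolding cap_def by linarith+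
    then have "d * real n / (real n powr (1/4) + 1)\<^sup>2 \<le> d * real n / (real (cap n))\<^sup>2"
      using d by (intro divide_left_mono power_mono) auto
    then have 2: "exp (- (\<epsilon>\<^sup>2 * real n / (32 * c\<^sup>2 * (real (cap n))\<^sup>2))) \<le> exp (- d * real n / (real n powr (1/4) + 1)\<^sup>2)"
      by (simp add: d_def)
    show ?thesis unfolding \<beta>_def h_def q_def[symmetric] using 1 2
      by (intro mult_left_mono add_mono) auto
  qed
  have "\<forall>\<^sub>F n in sequentially. h n \<le> 1 / real n ^ 2"
    unfolding h_def using a d by real_asymp
  then have ev: "\<forall>\<^sub>F n in sequentially. norm (\<beta> \<epsilon> n) \<le> 1 / real n ^ 2"
    using eventually_ge_at_top[of 1]
  proof eventually_elim
    case (elim n)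
    then show ?case using le[of n] \<open>0 \<le> \<beta> \<epsilon> n\<close> by simp
  qed
  have "summable (\<lambda>n. 1 / real n ^ 2)"
    using inverse_power_summable[of 2, where ?'a = real] by (simp add: field_simps)
  from summable_comparison_test_ev[OF ev this] show "summable (\<beta> \<epsilon>)" .
  then show "\<beta> \<epsilon> \<longlonglongrightarrow> 0" by (rule summable_LIMSEQ_zero)
qed

definition no_pairs :: "real \<Rightarrow> nat \<Rightarrow> (int + int \<Rightarrow> real) set" where
  "no_pairs \<epsilon> n = (\<Union>y\<in>{- int n..int n}. {w. \<not> pair_near (radius n) \<epsilon> y w})"

definition deviating :: "real \<Rightarrow> nat \<Rightarrow> (int + int \<Rightarrow> real) set" where
  "deviating \<epsilon> n = (\<Union>x\<in>{- int n..int n}. {w. \<bar>A' (cap n) n x w - (\<integral>w. A' (cap n) n x w \<partial>P)\<bar> \<ge> \<epsilon> * real n})"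

lemma pair_near_if_not_no_pairs: "w \<notin> no_pairs \<epsilon> n \<Longrightarrow> \<bar>y\<bar> \<le> int n \<Longrightarrow> pair_near (radius n) \<epsilon> y w"
  by (simp add: no_pairs_def abs_le_iff)

lemma no_pairs_sets [measurable]: "no_pairs \<epsilon> n \<in> sets P"
  and deviating_sets [measurable]: "deviating \<epsilon> n \<in> sets P"
  unfolding no_pairs_def deviating_def
  by (intro sets.finite_UN not_pair_near_sets deviation_sets; simp)+

lemma measure_bad:
  assumes \<epsilon>: "0 < \<epsilon>" and n: "1 \<le> n"
  shows "measure P (no_pairs \<epsilon> n) + measure P (deviating \<epsilon> n) \<le> \<beta> \<epsilon> n"
proof -
  let ?q = "(1 - measure \<mu> {c - \<epsilon>..} * measure \<mu> {..- (c - \<epsilon>)}) ^ (radius n div 2)"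
  let ?t = "2 * exp (- (\<epsilon>\<^sup>2 * real n / (32 * c\<^sup>2 * (real (cap n))\<^sup>2)))"
  have "measure P (no_pairs \<epsilon> n) \<le> (\<Sum>y\<in>{- int n..int n}. measure P {w. \<not> pair_near (radius n) \<epsilon> y w})"
    unfolding no_pairs_def by (intro P.finite_measure_subadditive_finite) (use not_pair_near_sets in auto)
  also have "\<dots> \<le> (\<Sum>y\<in>{- int n..int n}. ?q)" by (intro sum_mono prob_not_pair_near)
  finally have 1: "measure P (no_pairs \<epsilon> n) \<le> real (2 * n + 1) * ?q" by (simp add: add.commute)
  have "measure P (deviating \<epsilon> n)
      \<le> (\<Sum>x\<in>{- int n..int n}. measure P {w. \<bar>A' (cap n) n x w - (\<integral>w. A' (cap n) n x w \<partial>P)\<bar> \<ge> \<epsilon> * real n})"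
    unfolding deviating_def by (intro P.finite_measure_subadditive_finite) (use deviation_sets in auto)
  also have "\<dots> \<le> (\<Sum>x\<in>{- int n..int n}. ?t)"
    by (intro sum_mono A'_concentration n cap_ge_1 \<epsilon>) auto
  finally have "measure P (deviating \<epsilon> n) \<le> real (2 * n + 1) * ?t" by (simp add: add.commute)
  with 1 show ?thesis unfolding \<beta>_def by (simp add: distrib_left)
qed

text \<open>Concentration holds around the mean of \<open>A'\<close>, so the gap between the two
  means has to be small as well. Where pairs are missing the actions still differ by at most
  \<open>2 * c * n\<close>, and this event has probability at most
  \<open>\<beta> \<epsilon> n\<close>.\<close>

lemma e_le_expectation_A':
  assumes \<epsilon>: "0 < \<epsilon>" "\<epsilon> \<le> c" and n: "1 \<le> n" and x: "\<bar>x\<bar> \<le> int n"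
  shows "e n x \<le> (\<integral>w. A' (cap n) n x w \<partial>P) + (\<epsilon> + 4 * c * (real (radius n) / real (cap n)) + 2 * c * \<beta> \<epsilon> n) * real n"
proof -
  let ?\<delta> = "\<epsilon> + 4 * c * real (radius n) / real (cap n)"
  have \<delta>: "0 \<le> ?\<delta>" using \<epsilon> c by simp
  have "AE w in P. A n x w \<le> A' (cap n) n x w + (?\<delta> * real n + 2 * c * real n * indicator (no_pairs \<epsilon> n) w)"
    using bE_sign
  proof eventually_elim
    case (elim w)
    show ?case
    proof (cases "w \<in> no_pairs \<epsilon> n")
      case True
      have "0 \<le> ?\<delta> * real n" using \<delta> by simp
      then show ?thesis using True abs_A[OF x, of w] abs_A'[OF x, of "cap n" w] by simp
    next
      case False
      then have "pair_near (radius n) \<epsilon> y w" if "\<bar>y\<bar> \<le> int n" for y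
        using that by (rule pair_near_if_not_no_pairs)
      then have "A n x w \<le> A' (cap n) n x w + ?\<delta> * real n"
        using elim \<epsilon> n x by (intro A_le_A'_of_pairs radius_ge_1 cap_ge_1) auto
      then show ?thesis using False by simp
    qed
  qed
  then have "e n x \<le> (\<integral>w. A' (cap n) n x w + (?\<delta> * real n + 2 * c * real n * indicator (no_pairs \<epsilon> n) w) \<partial>P)"
    unfolding e_def using A_integrable[OF x] A'_integrable[OF x]
    by (intro integral_mono_AE Bochner_Integration.integrable_add) (auto simp: P.emeasure_eq_measure)
  also have "\<dots> = (\<integral>w. A' (cap n) n x w \<partial>P) + (?\<delta> * real n + 2 * c * real n * measure P (no_pairs \<epsilon> n))"
    using A'_integrable[OF x] by (simp add: Bochner_Integration.integral_add P.emeasure_eq_measure)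
  also have "2 * c * real n * measure P (no_pairs \<epsilon> n) \<le> 2 * c * real n * \<beta> \<epsilon> n"
    using order_trans[OF _ measure_bad[OF \<epsilon>(1) n]] c by (intro mult_left_mono) auto
  finally show ?thesis by (simp add: algebra_simps)
qed

lemma A_close_to_e_eventually:
  assumes \<epsilon>: "0 < \<epsilon>" "\<epsilon> \<le> c"
  shows "AE w in P. \<forall>\<^sub>F n in sequentially. \<forall>x. \<bar>x\<bar> \<le> int n \<longrightarrow> \<bar>A n x w - e n x\<bar> \<le> 4 * \<epsilon> * real n"
proof -
  let ?Bad = "\<lambda>n. no_pairs \<epsilon> n \<union> deviating \<epsilon> n"
  have "summable (\<lambda>n. measure P (?Bad n))"
  proof (rule summable_comparison_test_ev[OF _ summable_\<beta>(1)[OF \<epsilon>(1)]])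
    have "measure P (?Bad n) \<le> \<beta> \<epsilon> n" if "n \<ge> 1" for n
      using measure_bad[OF \<epsilon>(1) that] measure_Un_le[OF no_pairs_sets deviating_sets, of \<epsilon> n \<epsilon> n] by linarith
    then show "\<forall>\<^sub>F n in sequentially. norm (measure P (?Bad n)) \<le> \<beta> \<epsilon> n"
      by (auto intro: eventually_sequentiallyI[of 1])
  qed
  then have "AE w in P. \<forall>\<^sub>F n in sequentially. w \<in> space P - ?Bad n"
    by (intro borel_cantelli_AE1) (auto simp: P.emeasure_eq_measure)
  then have ae: "AE w in P. (\<forall>\<^sub>F n in sequentially. w \<in> space P - ?Bad n) \<and> (\<forall>i. bE w i = 1 \<or> bE w i = -1)"
    using bE_sign by eventually_elim auto
  have small: "\<forall>\<^sub>F n in sequentially. 8 * c * (real (radius n) / real (cap n)) + 2 * c * \<beta> \<epsilon> n < \<epsilon>"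
  proof (rule order_tendstoD(2))
    show "(\<lambda>n. 8 * c * (real (radius n) / real (cap n)) + 2 * c * \<beta> \<epsilon> n) \<longlonglongrightarrow> 8 * c * 0 + 2 * c * 0"
      by (intro tendsto_intros radius_over_cap summable_\<beta>(2)[OF \<epsilon>(1)])
  qed (use \<epsilon> in simp)
  from ae show ?thesis
  proof eventually_elim
    case (elim w)
    from elim[THEN conjunct1] small eventually_ge_at_top[of 1] show ?case
    proof eventually_elim
      case n: (elim n)
      show ?case
      proof (intro allI impI)
        fix x assume x: "\<bar>x\<bar> \<le> int n"
        let ?E = "\<integral>w. A' (cap n) n x w \<partial>P" and ?\<rho> = "real (radius n) / real (cap n)"
        have "pair_near (radius n) \<epsilon> y w" if "\<bar>y\<bar> \<le> int n" for y
          using that n(1) by (intro pair_near_if_not_no_pairs) auto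
        then have "A n x w \<le> A' (cap n) n x w + (\<epsilon> + 4 * c * real (radius n) / real (cap n)) * real n"
          using elim \<epsilon> n x by (intro A_le_A'_of_pairs radius_ge_1 cap_ge_1) auto
        then have 1: "A n x w \<le> A' (cap n) n x w + (\<epsilon> + 4 * c * ?\<rho>) * real n" by simp
        have 2: "A' (cap n) n x w \<le> A n x w" by (rule A'_le_A[OF x])
        have 3: "\<bar>A' (cap n) n x w - ?E\<bar> < \<epsilon> * real n" using n(1) x by (auto simp: deviating_def not_le abs_le_iff)
        have 4: "?E \<le> e n x" unfolding e_def
          using A'_le_A[OF x] A_integrable[OF x] A'_integrable[OF x] by (intro integral_mono) auto
        have 5: "e n x \<le> ?E + (\<epsilon> + 4 * c * ?\<rho> + 2 * c * \<beta> \<epsilon> n) * real n"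
          by (rule e_le_expectation_A'[OF \<epsilon> n(3) x])
        have "0 \<le> 4 * c * ?\<rho>" "0 \<le> 2 * c * \<beta> \<epsilon> n" using c summable_\<beta>(3)[OF \<epsilon>(1)] by simp_all
        moreover have "8 * c * ?\<rho> = 2 * (4 * c * ?\<rho>)" by simp
        \<comment> \<open>The first bound is for \<open>A\<close> against \<open>A'\<close>, the
          second for \<open>e\<close> against the mean of \<open>A'\<close>. Since
          \<open>A' \<le> A\<close> and the means are ordered alike, each direction uses one of them
          plus the deviation \<open>\<epsilon>\<close>, in all at most
          \<open>3 * \<epsilon> * n\<close>.\<close>
        ultimately have 6: "\<epsilon> + 4 * c * ?\<rho> \<le> 2 * \<epsilon>" "\<epsilon> + 4 * c * ?\<rho> + 2 * c * \<beta> \<epsilon> n \<le> 2 * \<epsilon>"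
          using n(2) by linarith+
        have "(\<epsilon> + 4 * c * ?\<rho>) * real n \<le> 2 * \<epsilon> * real n"
          "(\<epsilon> + 4 * c * ?\<rho> + 2 * c * \<beta> \<epsilon> n) * real n \<le> 2 * \<epsilon> * real n"
          by (intro mult_right_mono 6; simp)+
        moreover have "0 \<le> \<epsilon> * real n" using \<epsilon> by simp
        moreover have "2 * \<epsilon> * real n = 2 * (\<epsilon> * real n)" "4 * \<epsilon> * real n = 4 * (\<epsilon> * real n)" by simp_all
        ultimately show "\<bar>A n x w - e n x\<bar> \<le> 4 * \<epsilon> * real n" using 1 2 3 4 5 by linarith
      qed
    qed
  qed
qed

text \<open>The tolerances \<open>c / (k + 1)\<close> are countably many, which keeps the
  exceptional set null; uniformity in \<open>x\<close> makes it independent of the speed.\<close>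

theorem A_close_to_e:
  "AE w in P. \<forall>\<epsilon>>0. \<forall>\<^sub>F n in sequentially. \<forall>x. \<bar>x\<bar> \<le> int n \<longrightarrow> \<bar>A n x w - e n x\<bar> \<le> \<epsilon> * real n"
proof -
  have "AE w in P. \<forall>k. \<forall>\<^sub>F n in sequentially. \<forall>x. \<bar>x\<bar> \<le> int n \<longrightarrow> \<bar>A n x w - e n x\<bar> \<le> 4 * (c / real (Suc k)) * real n"
    unfolding AE_all_countable using c by (intro allI A_close_to_e_eventually) (auto simp: field_simps)
  then show ?thesis
  proof eventually_elim
    case (elim w)
    show ?case
    proof (intro allI impI)
      fix \<epsilon> :: real assume \<epsilon>: "\<epsilon> > 0"
      obtain k where "4 * c / \<epsilon> < real k" using reals_Archimedean2 by blast
      then have k: "4 * (c / real (Suc k)) \<le> \<epsilon>" using \<epsilon> by (simp add: field_simps)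
      from elim[rule_format, of k]
      show "\<forall>\<^sub>F n in sequentially. \<forall>x. \<bar>x\<bar> \<le> int n \<longrightarrow> \<bar>A n x w - e n x\<bar> \<le> \<epsilon> * real n"
      proof eventually_elim
        case (elim n)
        have "4 * (c / real (Suc k)) * real n \<le> \<epsilon> * real n" by (rule mult_right_mono[OF k]) simp
        then show ?case using elim by force
      qed
    qed
  qed
qed

subsection \<open>The limit shape\<close>

definition \<phi> :: "real \<Rightarrow> real" where
  "\<phi> \<alpha> = lim (\<lambda>n. e n (intpart (\<alpha> * real n)) / real n)"

lemma limit_of_ratio:
  assumes a: "\<bar>\<alpha>\<bar> < 1" and x: "(\<lambda>n. real_of_int (x n) / real n) \<longlonglongrightarrow> \<alpha>" "\<And>n. \<bar>x n\<bar> \<le> int n"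
  shows "(\<lambda>n. e n (x n) / real n) \<longlonglongrightarrow> \<phi> \<alpha>"
proof -
  obtain l where l: "\<And>x :: nat \<Rightarrow> int. (\<lambda>n. real_of_int (x n) / real n) \<longlonglongrightarrow> \<alpha> \<Longrightarrow>
    (\<And>n. \<bar>x n\<bar> \<le> int n) \<Longrightarrow> (\<lambda>n. e n (x n) / real n) \<longlonglongrightarrow> l"
    using limit_exists[OF a c] by blast
  have "(\<lambda>n. e n (intpart (\<alpha> * real n)) / real n) \<longlonglongrightarrow> l"
    using a by (intro l intpart_ratio_tendsto abs_intpart_le_nat) auto
  then have "\<phi> \<alpha> = l" unfolding \<phi>_def by (rule limI)
  then show ?thesis using l[OF x] by simp
qed

lemma e_ratio_bounds:
  assumes s: "s > 0" and th: "\<theta> \<ge> 0" and x: "\<bar>x\<bar> \<le> int n" and n: "n > 0"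
  shows "- ((\<theta> * (1 - \<bar>real_of_int x / real n\<bar>) + 2 * exp (- \<theta>)) / s + s * c\<^sup>2 / 2) \<le> e n x / real n"
    and "e n x / real n \<le> 0"
proof -
  have "- e n x / real n \<le> ((\<theta> * (real n - \<bar>real_of_int x\<bar>) + real n * (2 * exp (- \<theta>))) / s + real n * s * c\<^sup>2 / 2) / real n"
    using e_lower_bound[OF s th x] by (intro divide_right_mono) auto
  also have "\<dots> = (\<theta> * (1 - \<bar>real_of_int x / real n\<bar>) + 2 * exp (- \<theta>)) / s + s * c\<^sup>2 / 2"
    using s n by (simp add: field_simps)
  finally show "- ((\<theta> * (1 - \<bar>real_of_int x / real n\<bar>) + 2 * exp (- \<theta>)) / s + s * c\<^sup>2 / 2) \<le> e n x / real n"
    by simp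
  show "e n x / real n \<le> 0" using e_nonpos[OF x] by (simp add: divide_nonpos_nonneg)
qed

text \<open>The order of choice matters: \<open>s\<close> makes the moment term
  \<open>h / 2\<close>, then \<open>\<theta>\<close> and \<open>\<delta>\<close> bring the two parts
  of the entropy term, which are divided by \<open>s\<close>, below \<open>h / 4\<close> each. The
  variable \<open>u\<close> stands for the deficit \<open>1 - \<bar>\<alpha>\<bar>\<close>.\<close>

lemma entropy_bound_small:
  assumes h: "h > 0"
  obtains s \<theta> \<delta> where "s > 0" "\<theta> \<ge> 0" "\<delta> > 0"
    "\<And>u. u \<le> \<delta> \<Longrightarrow> (\<theta> * u + 2 * exp (- \<theta>)) / s + s * c\<^sup>2 / 2 \<le> h"
proof -
  define s where "s = h / c\<^sup>2"
  have s: "s > 0" using h c by (simp add: s_def)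
  have hs: "h * s / 4 > 0" using h s by simp
  define \<theta> where "\<theta> = max 1 (- ln (h * s / 8))"
  have th: "\<theta> \<ge> 1" by (simp add: \<theta>_def)
  have "exp (- \<theta>) \<le> exp (ln (h * s / 8))" unfolding \<theta>_def by simp
  also have "\<dots> = h * s / 8" using hs by simp
  finally have e1: "2 * exp (- \<theta>) \<le> h * s / 4" by simp
  define \<delta> where "\<delta> = h * s / (4 * \<theta>)"
  have d: "\<delta> > 0" using h s th by (simp add: \<delta>_def)
  have "(\<theta> * u + 2 * exp (- \<theta>)) / s + s * c\<^sup>2 / 2 \<le> h" if u: "u \<le> \<delta>" for u
  proof -
    have "\<theta> * u \<le> \<theta> * \<delta>" using u th by (intro mult_left_mono) auto
    also have "\<dots> = h * s / 4" using th by (simp add: \<delta>_def)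
    finally have "(\<theta> * u + 2 * exp (- \<theta>)) / s \<le> (h * s / 4 + h * s / 4) / s"
      using e1 s by (intro divide_right_mono) auto
    also have "\<dots> = h / 2" using s by simp
    finally have "(\<theta> * u + 2 * exp (- \<theta>)) / s \<le> h / 2" .
    moreover have "s * c\<^sup>2 / 2 = h / 2" using c by (simp add: s_def)
    ultimately show ?thesis by linarith
  qed
  then show ?thesis using that[of s \<theta> \<delta>] s th d by auto
qed

text \<open>\<open>limit_exists\<close> excludes these speeds. Here the deficit is exactly 0, so the
  upper bound and the lower bound with arbitrary tolerance force the mean to vanish for every
  positive \<open>n\<close>.\<close>

lemma limit_at_one:
  assumes "\<bar>\<alpha>\<bar> = 1"
  shows "(\<lambda>n. e n (intpart (\<alpha> * real n)) / real n) \<longlonglongrightarrow> 0" and "\<phi> \<alpha> = 0"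
proof -
  have ip: "\<bar>real_of_int (intpart (\<alpha> * real n)) / real n\<bar> = 1" if "n > 0" for n
  proof -
    have "\<alpha> = 1 \<or> \<alpha> = -1" using assms by linarith
    then have "intpart (\<alpha> * real n) = int n \<or> intpart (\<alpha> * real n) = - int n"
      using that by (auto simp: intpart_def)
    then show ?thesis using that by auto
  qed
  have z: "e n (intpart (\<alpha> * real n)) / real n = 0" if n: "n > 0" for n
  proof (rule antisym)
    have x: "\<bar>intpart (\<alpha> * real n)\<bar> \<le> int n" using assms by (intro abs_intpart_le_nat) auto
    show "e n (intpart (\<alpha> * real n)) / real n \<le> 0" by (rule e_ratio_bounds(2)[of 1 0, OF _ _ x n]) auto
    show "0 \<le> e n (intpart (\<alpha> * real n)) / real n"
    proof (rule field_le_epsilon)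
      fix h :: real assume "h > 0"
      then obtain s \<theta> \<delta> where *: "s > 0" "\<theta> \<ge> 0" "\<delta> > 0"
        "\<And>u. u \<le> \<delta> \<Longrightarrow> (\<theta> * u + 2 * exp (- \<theta>)) / s + s * c\<^sup>2 / 2 \<le> h"
        using entropy_bound_small by blast
      show "0 \<le> e n (intpart (\<alpha> * real n)) / real n + h"
        using e_ratio_bounds(1)[OF *(1,2) x n] *(4)[of 0] *(3) ip[OF n] by simp
    qed
  qed
  then have "\<forall>\<^sub>F n in sequentially. e n (intpart (\<alpha> * real n)) / real n = 0"
    by (auto intro: eventually_sequentiallyI[of 1])
  then show lim: "(\<lambda>n. e n (intpart (\<alpha> * real n)) / real n) \<longlonglongrightarrow> 0" by (rule tendsto_eventually)
  then show "\<phi> \<alpha> = 0" unfolding \<phi>_def by (rule limI)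
qed

lemma limit_e:
  assumes "\<alpha> \<in> {-1..1}"
  shows "(\<lambda>n. e n (intpart (\<alpha> * real n)) / real n) \<longlonglongrightarrow> \<phi> \<alpha>"
proof (cases "\<bar>\<alpha>\<bar> = 1")
  case True
  then show ?thesis using limit_at_one by simp
next
  case False
  then show ?thesis using assms by (intro limit_of_ratio intpart_ratio_tendsto abs_intpart_le_nat) auto
qed

lemma \<phi>_bounds:
  assumes a: "\<alpha> \<in> {-1..1}"
  shows "\<phi> \<alpha> \<le> 0"
    and "s > 0 \<Longrightarrow> \<theta> \<ge> 0 \<Longrightarrow> - ((\<theta> * (1 - \<bar>\<alpha>\<bar>) + 2 * exp (- \<theta>)) / s + s * c\<^sup>2 / 2) \<le> \<phi> \<alpha>"
proof -
  note x = abs_intpart_le_nat[OF a]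
  show "\<phi> \<alpha> \<le> 0"
    using e_ratio_bounds(2)[of 1 0, OF _ _ x]
    by (intro LIMSEQ_le_const2[OF limit_e[OF a]] exI[of _ 1]) auto
  assume s: "s > 0" "\<theta> \<ge> 0"
  have "(\<lambda>n. - ((\<theta> * (1 - \<bar>real_of_int (intpart (\<alpha> * real n)) / real n\<bar>) + 2 * exp (- \<theta>)) / s + s * c\<^sup>2 / 2))
      \<longlonglongrightarrow> - ((\<theta> * (1 - \<bar>\<alpha>\<bar>) + 2 * exp (- \<theta>)) / s + s * c\<^sup>2 / 2)"
    by (intro tendsto_intros intpart_ratio_tendsto) (use s in simp)
  from LIMSEQ_le[OF this limit_e[OF a]] e_ratio_bounds(1)[OF s x]
  show "- ((\<theta> * (1 - \<bar>\<alpha>\<bar>) + 2 * exp (- \<theta>)) / s + s * c\<^sup>2 / 2) \<le> \<phi> \<alpha>"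
    by (metis (no_types, lifting) Suc_le_eq One_nat_def)
qed

lemma \<phi>_even:
  assumes a: "\<alpha> \<in> {-1..1}"
  shows "\<phi> (- \<alpha>) = \<phi> \<alpha>"
  unfolding \<phi>_def using e_reflect[OF abs_intpart_le_nat[OF a]] by (simp add: intpart_minus)

text \<open>Spend a share \<open>1 - t\<close> of the time at speed \<open>\<alpha>\<close> and the
  rest at speed \<open>\<beta>\<close>; subadditivity joins the two legs.\<close>

lemma \<phi>_convex: "convex_on {-1..1} \<phi>"
proof (intro convex_onI)
  fix t \<alpha> \<beta> :: real assume t: "0 < t" "t < 1" and ab: "\<alpha> \<in> {-1..1}" "\<beta> \<in> {-1..1}"
  define \<gamma> where "\<gamma> = (1 - t) * \<alpha> + t * \<beta>"
  have \<gamma>: "\<gamma> \<in> {-1..1}"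
    using convexD_alt[of "{-1..1::real}" \<alpha> \<beta> t] ab t by (simp add: \<gamma>_def)
  show "\<phi> ((1 - t) *\<^sub>R \<alpha> + t *\<^sub>R \<beta>) \<le> (1 - t) * \<phi> \<alpha> + t * \<phi> \<beta>"
  \<comment> \<open>1 and -1 are extreme points of the interval, so a proper mixture equals one of
    them only if \<open>\<alpha> = \<beta>\<close>.\<close>
  proof (cases "\<bar>\<gamma>\<bar> = 1")
    case True
    have "\<alpha> = \<beta>"
    proof -
      consider "\<gamma> = 1" | "\<gamma> = -1" using True by linarith
      then show ?thesis
      proof cases
        case 1
        have "(1 - t) * (1 - \<alpha>) + t * (1 - \<beta>) = 0" using 1 by (simp add: \<gamma>_def algebra_simps)
        moreover have "0 \<le> (1 - t) * (1 - \<alpha>)" "0 \<le> t * (1 - \<beta>)" using t ab by auto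
        ultimately have "(1 - t) * (1 - \<alpha>) = 0" "t * (1 - \<beta>) = 0" by linarith+
        then show ?thesis using t by simp
      next
        case 2
        have "(1 - t) * (1 + \<alpha>) + t * (1 + \<beta>) = 0" using 2 by (simp add: \<gamma>_def algebra_simps)
        moreover have "0 \<le> (1 - t) * (1 + \<alpha>)" "0 \<le> t * (1 + \<beta>)" using t ab by auto
        ultimately have "(1 - t) * (1 + \<alpha>) = 0" "t * (1 + \<beta>) = 0" by linarith+
        then show ?thesis using t by auto
      qed
    qed
    then show ?thesis by (simp add: algebra_simps)
  next
    case False
    then have \<gamma>1: "\<bar>\<gamma>\<bar> < 1" using \<gamma> by auto
    define p where "p n = nat \<lfloor>t * real n\<rfloor>" for n
    have p_le: "p n \<le> n" for n
    proof -
      have "t * real n \<le> 1 * real n" using t by (intro mult_right_mono) auto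
      then show ?thesis unfolding p_def by linarith
    qed
    have p_real: "real (p n) \<le> t * real n" "t * real n - 1 \<le> real (p n)" for n
      unfolding p_def using t by (auto simp: of_nat_nat)
    have p_lim: "(\<lambda>n. real (p n) / real n) \<longlonglongrightarrow> t"
    proof (rule tendsto_sandwich)
      show "(\<lambda>n. t - 1 / real n) \<longlonglongrightarrow> t" using tendsto_diff[OF tendsto_const lim_1_over_n] by simp
      show "\<forall>\<^sub>F n in sequentially. t - 1 / real n \<le> real (p n) / real n"
        using p_real(2) by (auto intro!: eventually_sequentiallyI[of 1] simp: field_simps)
      show "\<forall>\<^sub>F n in sequentially. real (p n) / real n \<le> t"
        using p_real(1) by (auto intro!: eventually_sequentiallyI[of 1] simp: field_simps)
    qed simp
    have q_lim: "(\<lambda>n. real (n - p n) / real n) \<longlonglongrightarrow> 1 - t"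
    proof (rule Lim_transform_eventually[OF tendsto_diff[OF tendsto_const[of 1] p_lim]])
      show "\<forall>\<^sub>F n in sequentially. 1 - real (p n) / real n = real (n - p n) / real n"
        using p_le by (auto intro!: eventually_sequentiallyI[of 1] simp: of_nat_diff field_simps)
    qed
    have infinity: "filterlim (\<lambda>n. k n) at_top sequentially"
      if k: "(\<lambda>n. real (k n) / real n) \<longlonglongrightarrow> u" "u > 0" for k :: "nat \<Rightarrow> nat" and u
    proof -
      have prod: "filterlim (\<lambda>n. real (k n) / real n * real n) at_top sequentially"
        by (rule filterlim_tendsto_pos_mult_at_top[OF k filterlim_real_sequentially])
      have "\<forall>\<^sub>F n in sequentially. real (k n) / real n * real n = real (k n)"
        by (rule eventually_sequentiallyI[of 1]) simp
      from filterlim_cong[OF refl refl this] prod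
      have "filterlim (\<lambda>n. real (k n)) at_top sequentially" by (rule iffD1)
      then show ?thesis by (simp add: filterlim_sequentially_iff_filterlim_real)
    qed
    have p_inf: "filterlim p at_top sequentially" by (rule infinity[OF p_lim t(1)])
    have q_inf: "filterlim (\<lambda>n. n - p n) at_top sequentially" using t by (intro infinity[OF q_lim]) auto
    define xa where "xa n = intpart (\<alpha> * real (n - p n))" for n
    define xb where "xb n = intpart (\<beta> * real (p n))" for n
    have xa: "\<bar>xa n\<bar> \<le> int (n - p n)" and xb: "\<bar>xb n\<bar> \<le> int (p n)" for n
      unfolding xa_def xb_def by (intro abs_intpart_le_nat ab)+
    \<comment> \<open>Transfers a limit per unit of time to a leg of length \<open>k n\<close>,
      about \<open>u * n\<close>, normalised by the full time \<open>n\<close>.\<close>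
    have scale: "(\<lambda>n. g (k n) / real n) \<longlonglongrightarrow> l * u"
      if g: "(\<lambda>m. g m / real m) \<longlonglongrightarrow> l" and k: "(\<lambda>n. real (k n) / real n) \<longlonglongrightarrow> u" "filterlim k at_top sequentially"
      for g :: "nat \<Rightarrow> real" and k :: "nat \<Rightarrow> nat" and l u
    proof (rule Lim_transform_eventually)
      show "(\<lambda>n. g (k n) / real (k n) * (real (k n) / real n)) \<longlonglongrightarrow> l * u"
        by (rule tendsto_mult[OF filterlim_compose[OF g k(2)] k(1)])
      have "\<forall>\<^sub>F n in sequentially. k n \<ge> 1" using k(2) by (auto simp: filterlim_at_top)
      then show "\<forall>\<^sub>F n in sequentially. g (k n) / real (k n) * (real (k n) / real n) = g (k n) / real n"
        by eventually_elim simp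
    qed
    have "(\<lambda>n. real_of_int (xa n) / real n + real_of_int (xb n) / real n) \<longlonglongrightarrow> \<alpha> * (1 - t) + \<beta> * t"
      unfolding xa_def xb_def
      by (intro tendsto_add scale[OF intpart_ratio_tendsto q_lim q_inf] scale[OF intpart_ratio_tendsto p_lim p_inf])
    then have ratio: "(\<lambda>n. real_of_int (xa n + xb n) / real n) \<longlonglongrightarrow> \<gamma>"
      by (simp add: \<gamma>_def add_divide_distrib mult.commute)
    have ab_le: "\<bar>xa n + xb n\<bar> \<le> int n" for n using xa[of n] xb[of n] p_le[of n] by linarith
    \<comment> \<open>\<open>xa n + xb n\<close> need not be the integer part of
      \<open>\<gamma> * n\<close>; convergence of the ratio is enough.\<close>
    have L: "(\<lambda>n. e n (xa n + xb n) / real n) \<longlonglongrightarrow> \<phi> \<gamma>" by (rule limit_of_ratio[OF \<gamma>1 ratio ab_le])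
    have R: "(\<lambda>n. e (n - p n) (xa n) / real n + e (p n) (xb n) / real n) \<longlonglongrightarrow> \<phi> \<alpha> * (1 - t) + \<phi> \<beta> * t"
      unfolding xa_def xb_def
      by (intro tendsto_add scale[OF limit_e[OF ab(1)] q_lim q_inf] scale[OF limit_e[OF ab(2)] p_lim p_inf])
    have "e n (xa n + xb n) / real n \<le> e (n - p n) (xa n) / real n + e (p n) (xb n) / real n" for n
    proof -
      have "e n (xa n + xb n) \<le> e (n - p n) (xa n) + e (p n) (xb n)"
        using subadd[OF xa xb, of n n] p_le[of n] by simp
      then show ?thesis by (simp add: divide_right_mono flip: add_divide_distrib)
    qed
    then have "\<phi> \<gamma> \<le> \<phi> \<alpha> * (1 - t) + \<phi> \<beta> * t" by (intro LIMSEQ_le[OF L R]) auto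
    then show ?thesis by (simp add: \<gamma>_def mult.commute)
  qed
qed simp

text \<open>A convex function is continuous in the open interval but may jump up at its ends. The
  values there are 0, and the entropy bound from below together with \<open>\<phi> \<le> 0\<close>
  excludes a jump.\<close>

lemma \<phi>_continuous: "continuous_on {-1..1} \<phi>"
proof (rule continuous_on_eq_continuous_within[THEN iffD2], rule ballI)
  fix \<alpha> :: real assume a: "\<alpha> \<in> {-1..1}"
  show "continuous (at \<alpha> within {-1..1}) \<phi>"
  proof (cases "\<bar>\<alpha>\<bar> = 1")
    case False
    then have \<alpha>: "\<alpha> \<in> {-1<..<1}" using a by auto
    have "convex_on {-1<..<1} \<phi>" by (rule convex_on_subset[OF \<phi>_convex]) auto
    then have "continuous_on {-1<..<1} \<phi>" by (intro convex_on_continuous) auto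
    then have "isCont \<phi> \<alpha>" using \<alpha> by (simp add: continuous_on_eq_continuous_at)
    then show ?thesis by (rule continuous_at_imp_continuous_at_within)
  next
    case True
    have "\<phi> \<alpha> = 0" by (rule limit_at_one(2)[OF True])
    show ?thesis unfolding continuous_within_eps_delta
    proof (intro allI impI)
      fix h :: real assume "h > 0"
      then obtain s \<theta> \<delta> where *: "s > 0" "\<theta> \<ge> 0" "\<delta> > 0"
        "\<And>u. u \<le> \<delta> \<Longrightarrow> (\<theta> * u + 2 * exp (- \<theta>)) / s + s * c\<^sup>2 / 2 \<le> h / 2"
        using entropy_bound_small[of "h / 2"] by auto
      have "dist (\<phi> x) (\<phi> \<alpha>) < h" if x: "x \<in> {-1..1}" "dist x \<alpha> < \<delta>" for x
      proof -
        have "1 - \<bar>x\<bar> \<le> \<delta>" using x True unfolding dist_real_def by linarith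
        then show ?thesis
          using \<phi>_bounds(1)[OF x(1)] \<phi>_bounds(2)[OF x(1) *(1,2)] *(4)[of "1 - \<bar>x\<bar>"] \<open>\<phi> \<alpha> = 0\<close> \<open>h > 0\<close>
          unfolding dist_real_def by linarith
      qed
      then show "\<exists>d>0. \<forall>x\<in>{-1..1}. dist x \<alpha> < d \<longrightarrow> dist (\<phi> x) (\<phi> \<alpha>) < h" using *(3) by blast
    qed
  qed
qed

lemma A_limit: "AE w in P. \<forall>\<alpha>\<in>{-1..1}. (\<lambda>n. A n (intpart (\<alpha> * real n)) w / real n) \<longlonglongrightarrow> \<phi> \<alpha>"
  using A_close_to_e
proof eventually_elim
  case (elim w)
  show ?case
  proof
    fix \<alpha> :: real assume a: "\<alpha> \<in> {-1..1}"
    let ?x = "\<lambda>n. intpart (\<alpha> * real n)"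
    have "(\<lambda>n. A n (?x n) w / real n - e n (?x n) / real n) \<longlonglongrightarrow> 0"
    proof (rule LIMSEQ_I)
      fix h :: real assume h: "h > 0"
      then have "\<forall>\<^sub>F n in sequentially. \<forall>x. \<bar>x\<bar> \<le> int n \<longrightarrow> \<bar>A n x w - e n x\<bar> \<le> h / 2 * real n"
        by (intro elim[rule_format]) simp
      then have "\<forall>\<^sub>F n in sequentially. norm (A n (?x n) w / real n - e n (?x n) / real n - 0) < h"
        using eventually_ge_at_top[of 1]
      proof eventually_elim
        case n: (elim n)
        have "\<bar>A n (?x n) w - e n (?x n)\<bar> / real n \<le> h / 2"
          using n abs_intpart_le_nat[OF a, of n] by (simp add: field_simps)
        then have "\<bar>A n (?x n) w - e n (?x n)\<bar> / real n < h" using h by linarith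
        then show ?case by (simp flip: diff_divide_distrib)
      qed
      then show "\<exists>no. \<forall>n\<ge>no. norm (A n (?x n) w / real n - e n (?x n) / real n - 0) < h"
        by (simp add: eventually_sequentially)
    qed
    from tendsto_add[OF this limit_e[OF a]]
    show "(\<lambda>n. A n (?x n) w / real n) \<longlonglongrightarrow> \<phi> \<alpha>" by simp
  qed
qed

end

section \<open>The shape theorem\<close>

theorem theorem2p1:
  fixes M :: "'a measure"
    and F B :: "int \<Rightarrow> 'a \<Rightarrow> real"
    and \<rho> :: "real \<Rightarrow> real"
    and c q \<kappa> :: real
  assumes "prob_space M"
    and "c > 0" and "q > 0" and "\<kappa> > -1"
    and indep: "prob_space.indep_vars M (\<lambda>_. borel)
                  (\<lambda>j. case j of Inl x \<Rightarrow> F x | Inr i \<Rightarrow> B i) (UNIV :: (int + int) set)"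
    and B_plus: "\<And>i. measure M {\<omega> \<in> space M. B i \<omega> = 1} = 1/2"
    and B_minus: "\<And>i. measure M {\<omega> \<in> space M. B i \<omega> = -1} = 1/2"
    and F_density: "\<And>x. distributed M lborel (F x) (\<lambda>y. ennreal (\<rho> y))"
    and rho_meas: "\<rho> \<in> borel_measurable borel"
    and rho_even: "\<And>y. \<rho> (- y) = \<rho> y"
    and rho_cont: "continuous_on {-c<..<c} \<rho>"
    and rho_pos: "\<And>y. y \<in> {-c<..<c} \<Longrightarrow> \<rho> y > 0"
    and rho_zero: "\<And>y. y \<notin> {-c<..<c} \<Longrightarrow> \<rho> y = 0"
    and rho_edge: "((\<lambda>y. \<rho> y / (\<bar>c - y\<bar> powr \<kappa>)) \<longlongrightarrow> q) (at_left c)"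
  shows "\<exists>\<Lambda> :: real \<Rightarrow> real.
           continuous_on {-1..1} \<Lambda> \<and>
           (\<forall>\<alpha>\<in>{-1..1}. \<Lambda> (- \<alpha>) = \<Lambda> \<alpha>) \<and>
           concave_on {-1..1} \<Lambda> \<and>
           (\<forall>\<alpha>\<in>{-1..1}. \<Lambda> \<alpha> \<ge> 0) \<and>
           (\<exists>\<Omega>0 \<in> sets M. measure M \<Omega>0 = 1 \<and>
              (\<forall>\<omega>\<in>\<Omega>0. \<forall>\<alpha>\<in>{-1..1}.
                 (\<lambda>n. min_action0 (\<lambda>i. B i \<omega>) (\<lambda>x. F x \<omega>) n (intpart (\<alpha> * real n)) / real n)
                   \<longlonglongrightarrow> - \<Lambda> \<alpha>))"
proof -
  interpret prob_space M by fact
  define X :: "int + int \<Rightarrow> 'a \<Rightarrow> real" where "X j = (case j of Inl x \<Rightarrow> F x | Inr i \<Rightarrow> B i)" for j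
  have X_indep: "indep_vars (\<lambda>_. borel) X UNIV" using indep unfolding X_def[abs_def] .
  then have X_rv: "random_variable borel (X j)" for j by (auto simp: indep_vars_def)
  have F_rv [measurable]: "random_variable borel (F x)" for x using X_rv[of "Inl x"] by (simp add: X_def)
  have B_rv [measurable]: "random_variable borel (B i)" for i using X_rv[of "Inr i"] by (simp add: X_def)
  define \<mu> where "\<mu> = density lborel (\<lambda>y. ennreal (\<rho> y))"
  define \<nu> where "\<nu> = distr M borel (B 0)"
  have F_law: "distr M borel (F x) = \<mu>" for x
  proof -
    have "distr M borel (F x) = distr M lborel (F x)" by (rule distr_cong) auto
    then show ?thesis using distributed_distr_eq_density[OF F_density] by (simp add: \<mu>_def)
  qed
  have B_AE: "AE \<omega> in M. B i \<omega> = 1 \<or> B i \<omega> = -1" for i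
  proof -
    have "prob {\<omega> \<in> space M. B i \<omega> = 1 \<or> B i \<omega> = -1}
        = prob ({\<omega> \<in> space M. B i \<omega> = 1} \<union> {\<omega> \<in> space M. B i \<omega> = -1})"
      by (rule arg_cong[where f = prob]) auto
    also have "\<dots> = prob {\<omega> \<in> space M. B i \<omega> = 1} + prob {\<omega> \<in> space M. B i \<omega> = -1}"
      by (rule finite_measure_Union) auto
    also have "\<dots> = 1" by (simp add: B_plus B_minus)
    finally show ?thesis by (intro AE_I_eq_1) (auto simp: emeasure_eq_measure)
  qed
  have B_law: "distr M borel (B i) = \<nu>" for i
  proof -
    \<comment> \<open>The two atoms carry all the mass and so determine the law, which makes all
      \<open>B i\<close> equal in distribution.\<close>
    have law: "prob (B i -` S \<inter> space M) = (if 1 \<in> S then 1/2 else 0) + (if -1 \<in> S then 1/2 else 0)"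
      if S: "S \<in> sets borel" for i S
    proof -
      let ?E = "\<lambda>y. if y \<in> S then {\<omega> \<in> space M. B i \<omega> = y} else {}"
      have "prob (B i -` S \<inter> space M) = prob (?E 1 \<union> ?E (-1))"
        using S B_AE[of i] by (intro finite_measure_eq_AE) auto
      also have "\<dots> = prob (?E 1) + prob (?E (-1))" by (rule finite_measure_Union) auto
      finally show ?thesis using B_plus[of i] B_minus[of i] by auto
    qed
    show ?thesis unfolding \<nu>_def
      by (rule measure_eqI) (auto simp: emeasure_distr emeasure_eq_measure law)
  qed
  interpret mu: prob_space \<mu> unfolding F_law[of 0, symmetric] by (rule prob_space_distr) measurable
  \<comment> \<open>If \<open>S\<close> were null, the density would vanish almost everywhere on an
    interval where it is positive, and the interval would have Lebesgue measure 0.\<close>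
  have mu_pos: "0 < measure \<mu> S"
    if S: "S \<in> sets borel" "{a<..<b} \<subseteq> S" and ab: "a < b" "-c \<le> a" "b \<le> c" for S a b
  proof (rule ccontr)
    assume "\<not> 0 < measure \<mu> S"
    then have "measure \<mu> S = 0" using measure_nonneg[of \<mu> S] by linarith
    then have "emeasure \<mu> S = 0" by (simp add: mu.emeasure_eq_measure)
    then have "(\<integral>\<^sup>+y. ennreal (\<rho> y) * indicator S y \<partial>lborel) = 0"
      using S rho_meas by (simp add: \<mu>_def emeasure_density)
    then have "AE y in lborel. ennreal (\<rho> y) * indicator S y = 0"
      using S rho_meas by (subst (asm) nn_integral_0_iff_AE) auto
    then have "AE y in lborel. y \<notin> {a<..<b}"
    proof eventually_elim
      case (elim y)
      show ?case
      proof
        assume y: "y \<in> {a<..<b}"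
        then have "y \<in> S" "\<rho> y > 0" using S ab by (auto intro!: rho_pos)
        then show False using elim by simp
      qed
    qed
    then have "{a<..<b} \<in> null_sets lborel" by (subst AE_iff_null_sets) auto
    then have "emeasure lborel {a<..<b} = 0" by (rule null_setsD1)
    then show False using ab by simp
  qed
  interpret E: random_environment c \<mu> \<nu>
  proof (rule random_environment.intro)
    show "0 < c" by fact
    show "prob_space \<mu>" by unfold_locales
    show "prob_space \<nu>" unfolding \<nu>_def by (rule prob_space_distr) measurable
    show "sets \<mu> = sets borel" "sets \<nu> = sets borel" by (simp_all add: \<mu>_def \<nu>_def)
    show "AE y in \<nu>. y = 1 \<or> y = -1" unfolding \<nu>_def using B_AE[of 0] by (subst AE_distr_iff) auto
    \<comment> \<open>The maximum with \<open>- c\<close> keeps the test interval inside the support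
      even for \<open>\<epsilon> > 2 * c\<close>.\<close>
    show "0 < measure \<mu> {c - \<epsilon>..}" if "0 < \<epsilon>" for \<epsilon>
      using that \<open>c > 0\<close> by (intro mu_pos[of _ "max (- c) (c - \<epsilon>)" c]) auto
    show "0 < measure \<mu> {..- (c - \<epsilon>)}" if "0 < \<epsilon>" for \<epsilon>
      using that \<open>c > 0\<close> by (intro mu_pos[of _ "- c" "min c (- (c - \<epsilon>))"]) auto
    have "(\<integral>y. clip 1 y \<partial>\<nu>) = (\<integral>\<omega>. clip 1 (B 0 \<omega>) \<partial>M)"
      unfolding \<nu>_def by (rule integral_distr) auto
    also have "\<dots> = (\<integral>\<omega>. indicator {\<omega> \<in> space M. B 0 \<omega> = 1} \<omega> - indicator {\<omega> \<in> space M. B 0 \<omega> = -1} \<omega> \<partial>M)"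
    proof (rule integral_cong_AE)
      show "AE \<omega> in M. clip 1 (B 0 \<omega>) = indicator {\<omega> \<in> space M. B 0 \<omega> = 1} \<omega> - indicator {\<omega> \<in> space M. B 0 \<omega> = -1} \<omega>"
        using B_AE[of 0] AE_space by eventually_elim (auto simp: clip_def)
    qed measurable
    also have "\<dots> = 0"
      by (subst Bochner_Integration.integral_diff) (auto simp: less_top[symmetric] B_plus B_minus intro!: integrable_real_indicator)
    finally show "(\<integral>y. clip 1 y \<partial>\<nu>) = 0" .
  qed
  have X_law: "distr M borel (X j) = E.D j" for j
    using F_law B_law by (cases j) (auto simp: X_def E.D_def)
  have X_meas: "(\<lambda>\<omega> j. X j \<omega>) \<in> measurable M (PiM UNIV (\<lambda>_. borel))"
    using X_rv by (intro measurable_PiM_single') auto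
  \<comment> \<open>Independence says that the joint law is the product of the marginals, so almost
    sure statements on the product space pull back to \<open>M\<close>.\<close>
  have joint: "distr M (PiM UNIV (\<lambda>_. borel)) (\<lambda>\<omega> j. X j \<omega>) = E.P"
  proof -
    have "distr M (PiM UNIV (\<lambda>_. borel)) (\<lambda>\<omega>. \<lambda>j\<in>UNIV. X j \<omega>) = PiM UNIV (\<lambda>j. distr M borel (X j))"
      using indep_vars_iff_distr_eq_PiM[of UNIV X "\<lambda>_. borel"] X_rv X_indep by auto
    then show ?thesis by (simp add: X_law E.P_def restrict_def)
  qed
  have lim: "AE \<omega> in M. \<forall>\<alpha>\<in>{-1..1}. (\<lambda>n. E.A n (intpart (\<alpha> * real n)) (\<lambda>j. X j \<omega>) / real n) \<longlonglongrightarrow> E.\<phi> \<alpha>"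
    using E.A_limit unfolding joint[symmetric] by (rule AE_distrD[OF X_meas])
  have F_AE: "AE \<omega> in M. \<bar>F x \<omega>\<bar> \<le> c" for x
  proof -
    have "AE y in distr M borel (F x). \<bar>y\<bar> \<le> c"
      unfolding F_law \<mu>_def using rho_meas
    proof (subst AE_density)
      have "\<bar>y\<bar> \<le> c" if "0 < ennreal (\<rho> y)" for y
        using that rho_zero[of y] by (cases "y \<in> {-c<..<c}") auto
      then show "AE y in lborel. 0 < ennreal (\<rho> y) \<longrightarrow> \<bar>y\<bar> \<le> c" by simp
    qed auto
    then show ?thesis by (rule AE_distrD[OF F_rv])
  qed
  have "AE \<omega> in M. \<forall>\<alpha>\<in>{-1..1}.
     (\<lambda>n. min_action0 (\<lambda>i. B i \<omega>) (\<lambda>x. F x \<omega>) n (intpart (\<alpha> * real n)) / real n) \<longlonglongrightarrow> - (- E.\<phi> \<alpha>)"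
  proof -
    \<comment> \<open>On this event of full measure clipping is the identity, and the action on the
      product space is the given one.\<close>
    have "AE \<omega> in M. (\<forall>i. B i \<omega> = 1 \<or> B i \<omega> = -1) \<and> (\<forall>x. \<bar>F x \<omega>\<bar> \<le> c)"
      using B_AE F_AE by (simp add: AE_all_countable)
    with lim show ?thesis
    proof eventually_elim
      case (elim \<omega>)
      have "\<bar>B i \<omega>\<bar> \<le> 1" for i using elim(2)[THEN conjunct1, rule_format, of i] by auto
      then have "E.bE (\<lambda>j. X j \<omega>) = (\<lambda>i. B i \<omega>)"
        by (intro ext) (simp add: E.bE_def X_def clip_eq)
      moreover have "E.fE (\<lambda>j. X j \<omega>) = (\<lambda>x. F x \<omega>)"
        using elim(2) by (intro ext) (simp add: E.fE_def X_def clip_eq)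
      ultimately show ?case using elim(1) by (simp add: E.A_def)
    qed
  qed
  \<comment> \<open>The event is the complement of a measurable null set covering the exceptions;
    this avoids measurability of a condition on uncountably many speeds.\<close>
  then obtain N where N: "{\<omega> \<in> space M. \<not> (\<forall>\<alpha>\<in>{-1..1}.
     (\<lambda>n. min_action0 (\<lambda>i. B i \<omega>) (\<lambda>x. F x \<omega>) n (intpart (\<alpha> * real n)) / real n) \<longlonglongrightarrow> - (- E.\<phi> \<alpha>))} \<subseteq> N"
     "emeasure M N = 0" "N \<in> sets M"
    by (rule AE_E)
  have "measure M N = 0" using N(2) by (simp add: measure_def)
  then have "measure M (space M - N) = 1" using N(3) by (simp add: prob_compl)
  moreover have "space M - N \<in> sets M" using N(3) by auto
  ultimately have "\<exists>\<Omega>0\<in>sets M. measure M \<Omega>0 = 1 \<and> (\<forall>\<omega>\<in>\<Omega>0. \<forall>\<alpha>\<in>{-1..1}.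
     (\<lambda>n. min_action0 (\<lambda>i. B i \<omega>) (\<lambda>x. F x \<omega>) n (intpart (\<alpha> * real n)) / real n) \<longlonglongrightarrow> - (- E.\<phi> \<alpha>))"
    using N(1) by (intro bexI[of _ "space M - N"]) blast+
  moreover have "continuous_on {-1..1} (\<lambda>\<alpha>. - E.\<phi> \<alpha>)" by (intro continuous_on_minus E.\<phi>_continuous)
  moreover have "concave_on {-1..1} (\<lambda>\<alpha>. - E.\<phi> \<alpha>)" using E.\<phi>_convex by (simp add: concave_on_def)
  ultimately show ?thesis
    using E.\<phi>_even E.\<phi>_bounds(1) by (intro exI[of _ "\<lambda>\<alpha>. - E.\<phi> \<alpha>"]) auto
qed

end
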